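(* Let $R$ be a unique factorisation domain. Let $G=F_n\rtimes\mathbb{Z}$ be a free-by-cyclic group with induced character $\varphi\colon G\to\mathbb{Z}$ and let $\rho\colon G\to\mathrm{GL}_k(R)$ be a representation. Then $$\tau_{G,R}^{\varphi,\rho}(t)=\frac{\Delta_{G,1}^{\varphi,\rho}(t)}{\Delta_{G,0}^{\varphi,\rho}(t)}$$ up to monomial factors with coefficients in $\mathrm{Frac}(R)^\times$.
   Context: $F_n$ is a non-trivial free group of finite rank $n$; the induced character of $F_n\rtimes\mathbb{Z}$ is the projection to $\mathbb{Z}$, killing $F_n$ and sending the stable letter to $1$. Give $R^k[t^{\pm1}]$ the $RG$-module structure in which $g\in G$ acts as $t^{\varphi(g)}\rho(g)$. The $i$th twisted Alexander polynomial $\Delta_{G,i}^{\varphi,\rho}(t)$ is the order of the $R[t^{\pm1}]$-module $H_i(G;R^k[t^{\pm1}])$, i.e. the greatest common divisor of all maximal minors in a presentation matrix with finitely many columns; it is well defined up to units of $R[t^{\pm1}]$. The twisted Reidemeister torsion is $$\tau_{G,R}^{\varphi,\rho}(t)\doteq\prod_{i\ge0}\left(\Delta_{G,i}^{\varphi,\rho}(t)\right)^{(-1)^{i+1}},$$ up to monomial factors with coefficients in $\mathrm{Frac}(R)^\times$. *)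

theory Defs
  imports
    "HOL-Analysis.Finite_Cartesian_Product"
    "HOL-Library.Poly_Mapping"
    "HOL-Computational_Algebra.Computational_Algebra"
    "HOL-Algebra.Bij"
    "HOL-Algebra.Elementary_Groups"
    "HOL-Algebra.Module"
    "Jordan_Normal_Form.Determinant"
begin

section \<open>Free-by-cyclic groups\<close>

text \<open>A word is a list of letters \<open>(x, b)\<close>; the letter stands for \<open>x\<close> if \<open>b\<close> holds and for the
  inverse of \<open>x\<close> otherwise.\<close>

definition word_value :: "('f, 'z) monoid_scheme \<Rightarrow> ('f \<times> bool) list \<Rightarrow> 'f" where
  "word_value F w =
     foldr (\<lambda>(x, b) y. (if b then x else inv\<^bsub>F\<^esub> x) \<otimes>\<^bsub>F\<^esub> y) w \<one>\<^bsub>F\<^esub>"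

definition reduced_word :: "('f \<times> bool) list \<Rightarrow> bool" where
  "reduced_word w \<longleftrightarrow> successively (\<lambda>(x, b) (y, c). \<not> (x = y \<and> b \<noteq> c)) w"

definition free_basis :: "('f, 'z) monoid_scheme \<Rightarrow> 'f set \<Rightarrow> bool" where
  "free_basis F X \<longleftrightarrow> X \<subseteq> carrier F \<and> generate F X = carrier F \<and>
     (\<forall>w. fst ` set w \<subseteq> X \<and> reduced_word w \<and> w \<noteq> [] \<longrightarrow> word_value F w \<noteq> \<one>\<^bsub>F\<^esub>)"

definition free_group_of_rank :: "('f, 'z) monoid_scheme \<Rightarrow> nat \<Rightarrow> bool" where
  "free_group_of_rank F n \<longleftrightarrow>
     group F \<and> (\<exists>X. finite X \<and> card X = n \<and> free_basis F X)"

definition semidirect_product ::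
    "('f, 'y) monoid_scheme \<Rightarrow> ('h, 'z) monoid_scheme \<Rightarrow> ('h \<Rightarrow> 'f \<Rightarrow> 'f) \<Rightarrow> ('f \<times> 'h) monoid" where
  "semidirect_product N H \<alpha> =
     \<lparr>carrier = carrier N \<times> carrier H,
      monoid.mult = (\<lambda>(x, a) (y, b). (x \<otimes>\<^bsub>N\<^esub> \<alpha> a y, a \<otimes>\<^bsub>H\<^esub> b)),
      one = (\<one>\<^bsub>N\<^esub>, \<one>\<^bsub>H\<^esub>)\<rparr>"

text \<open>The stable letter is \<open>(\<one>, 1)\<close>; conjugation by it is the automorphism \<open>\<alpha> 1\<close> of \<open>F\<close>.\<close>

abbreviation free_by_cyclic ::
    "('f, 'z) monoid_scheme \<Rightarrow> (int \<Rightarrow> 'f \<Rightarrow> 'f) \<Rightarrow> ('f \<times> int) monoid" where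
  "free_by_cyclic F \<alpha> \<equiv> semidirect_product F integer_group \<alpha>"

definition induced_character :: "'f \<times> int \<Rightarrow> int" where
  "induced_character = snd"

lemma group_semidirect_product:
  assumes "group N" "group H" "\<alpha> \<in> hom H (AutoGroup N)"
  shows "group (semidirect_product N H \<alpha>)"
proof -
  interpret N: group N by fact
  interpret H: group H by fact
  have auto: "\<alpha> a \<in> hom N N" "\<alpha> a \<in> Bij (carrier N)" if "a \<in> carrier H" for a
    using hom_in_carrier[OF assms(3) that] by (auto simp: AutoGroup_def auto_def)
  have closed: "\<alpha> a x \<in> carrier N" if "a \<in> carrier H" "x \<in> carrier N" for a x
    using hom_in_carrier[OF auto(1)] that by blast
  have mult: "\<alpha> a (x \<otimes>\<^bsub>N\<^esub> y) = \<alpha> a x \<otimes>\<^bsub>N\<^esub> \<alpha> a y"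
    if "a \<in> carrier H" "x \<in> carrier N" "y \<in> carrier N" for a x y
    using hom_mult[OF auto(1)] that by blast
  have comp: "\<alpha> (a \<otimes>\<^bsub>H\<^esub> b) x = \<alpha> a (\<alpha> b x)"
    if "a \<in> carrier H" "b \<in> carrier H" "x \<in> carrier N" for a b x
    using hom_mult[OF assms(3) that(1,2)] auto that
    by (simp add: AutoGroup_def BijGroup_def compose_def)
  have one: "\<alpha> \<one>\<^bsub>H\<^esub> x = x" if "x \<in> carrier N" for x
    using hom_one[OF assms(3) assms(2) N.AutoGroup] that
    by (simp add: AutoGroup_def BijGroup_def)
  show ?thesis
  proof (rule groupI)
    fix g assume g: "g \<in> carrier (semidirect_product N H \<alpha>)"
    then obtain x a where xa: "g = (x, a)" "x \<in> carrier N" "a \<in> carrier H"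
      by (auto simp: semidirect_product_def)
    let ?h = "(\<alpha> (inv\<^bsub>H\<^esub> a) (inv\<^bsub>N\<^esub> x), inv\<^bsub>H\<^esub> a)"
    have "\<alpha> (inv\<^bsub>H\<^esub> a) (inv\<^bsub>N\<^esub> x) \<otimes>\<^bsub>N\<^esub> \<alpha> (inv\<^bsub>H\<^esub> a) x = \<one>\<^bsub>N\<^esub>"
      using xa mult[of "inv\<^bsub>H\<^esub> a" "inv\<^bsub>N\<^esub> x" x, symmetric] hom_one[OF auto(1) assms(1) assms(1)]
      by simp
    then show "\<exists>h\<in>carrier (semidirect_product N H \<alpha>).
        h \<otimes>\<^bsub>semidirect_product N H \<alpha>\<^esub> g = \<one>\<^bsub>semidirect_product N H \<alpha>\<^esub>"
      using xa closed by (intro bexI[of _ ?h]) (auto simp: semidirect_product_def)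
  qed (auto simp: semidirect_product_def closed mult comp one N.m_assoc H.m_assoc)
qed

lemma induced_character_hom:
  "induced_character \<in> hom (free_by_cyclic F \<alpha>) integer_group"
  by (auto simp: hom_def semidirect_product_def induced_character_def integer_group_def)


section \<open>Group homology\<close>

text \<open>Let \<open>G\<close> act on an abelian group from the left by \<open>act\<close>. The bar complex computing the homology
  of \<open>G\<close> with these coefficients is the tensor product over the integral group ring of the
  inhomogeneous bar resolution of the trivial right module with the coefficients. A chain of degree
  \<open>n\<close> is a finitely supported function on \<open>n\<close>-tuples, and \<open>single [g\<^sub>1,\<dots>,g\<^sub>n] m\<close> is the
  chain \<open>[g\<^sub>1|\<dots>|g\<^sub>n] \<otimes> m\<close>. Its boundary is
  \<open>[g\<^sub>2|\<dots>|g\<^sub>n] \<otimes> m + (\<Sum>0<i<n. (-1)^i [g\<^sub>1|\<dots>|g\<^sub>i g\<^sub>i\<^sub>+\<^sub>1|\<dots>|g\<^sub>n] \<otimes> m)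
    + (-1)^n [g\<^sub>1|\<dots>|g\<^sub>n\<^sub>-\<^sub>1] \<otimes> g\<^sub>n m\<close>.\<close>

definition bar_face ::
    "('g, 'z) monoid_scheme \<Rightarrow> ('g \<Rightarrow> 'm \<Rightarrow> 'm) \<Rightarrow> nat \<Rightarrow> 'g list \<Rightarrow> 'm \<Rightarrow> ('g list \<Rightarrow>\<^sub>0 'm::ab_group_add)"
  where
  "bar_face G act i gs m =
     (if i = 0 then Poly_Mapping.single (tl gs) m
      else if i = length gs then Poly_Mapping.single (butlast gs) (act (last gs) m)
      else Poly_Mapping.single
             (take (i - 1) gs @ [gs ! (i - 1) \<otimes>\<^bsub>G\<^esub> gs ! i] @ drop (i + 1) gs) m)"

definition bar_boundary ::
    "('g, 'z) monoid_scheme \<Rightarrow> ('g \<Rightarrow> 'm \<Rightarrow> 'm) \<Rightarrow> ('g list \<Rightarrow>\<^sub>0 'm) \<Rightarrow> ('g list \<Rightarrow>\<^sub>0 'm::ab_group_add)"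
  where
  "bar_boundary G act c =
     (\<Sum>gs\<in>Poly_Mapping.keys c. if gs = [] then 0 else
        \<Sum>i\<le>length gs. (if even i then bar_face G act i gs (Poly_Mapping.lookup c gs)
                       else - bar_face G act i gs (Poly_Mapping.lookup c gs)))"

definition bar_chains :: "('g, 'z) monoid_scheme \<Rightarrow> nat \<Rightarrow> ('g list \<Rightarrow>\<^sub>0 'm::ab_group_add) set" where
  "bar_chains G n = {c. \<forall>gs\<in>Poly_Mapping.keys c. length gs = n \<and> set gs \<subseteq> carrier G}"

definition bar_cycles ::
    "('g, 'z) monoid_scheme \<Rightarrow> ('g \<Rightarrow> 'm \<Rightarrow> 'm) \<Rightarrow> nat \<Rightarrow> ('g list \<Rightarrow>\<^sub>0 'm::ab_group_add) set" where
  "bar_cycles G act n = {c \<in> bar_chains G n. bar_boundary G act c = 0}"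

definition bar_boundaries ::
    "('g, 'z) monoid_scheme \<Rightarrow> ('g \<Rightarrow> 'm \<Rightarrow> 'm) \<Rightarrow> nat \<Rightarrow> ('g list \<Rightarrow>\<^sub>0 'm::ab_group_add) set" where
  "bar_boundaries G act n = bar_boundary G act ` bar_chains G (Suc n)"

text \<open>The quotient \<open>Z / B\<close> of submodules of a module with scalar multiplication \<open>sm\<close>. The ring
  fields \<open>mult\<close> and \<open>one\<close> of the record play no role for modules.\<close>

definition quotient_module ::
    "('l \<Rightarrow> 'c \<Rightarrow> 'c) \<Rightarrow> 'c set \<Rightarrow> 'c set \<Rightarrow> ('l, 'c::ab_group_add set) module" where
  "quotient_module sm Z B =
     \<lparr>carrier = (\<lambda>z. (+) z ` B) ` Z,
      monoid.mult = undefined, one = undefined,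
      zero = B,
      add = (\<lambda>X Y. {x + y | x y. x \<in> X \<and> y \<in> Y}),
      smult = (\<lambda>a X. {sm a x + b | x b. x \<in> X \<and> b \<in> B})\<rparr>"

text \<open>If the coefficients carry a scalar multiplication commuting with the action of \<open>G\<close>, the
  homology groups are modules over the scalars.\<close>

definition group_homology ::
    "('g, 'z) monoid_scheme \<Rightarrow> ('l \<Rightarrow> 'm \<Rightarrow> 'm) \<Rightarrow> ('g \<Rightarrow> 'm \<Rightarrow> 'm) \<Rightarrow> nat
      \<Rightarrow> ('l, ('g list \<Rightarrow>\<^sub>0 'm::ab_group_add) set) module" where
  "group_homology G sm act n =
     quotient_module (\<lambda>a. Poly_Mapping.map (sm a)) (bar_cycles G act n) (bar_boundaries G act n)"


section \<open>The order of a module\<close>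

text \<open>A matrix with \<open>s\<close> columns and possibly infinitely many rows is given by the set \<open>A\<close> of its
  rows: columns correspond to generators of the module and rows to relations. Repeating or reordering
  rows changes neither the span of the rows nor the greatest common divisor of the minors.\<close>

definition row_span :: "nat \<Rightarrow> 'l::comm_ring_1 Matrix.vec set \<Rightarrow> 'l Matrix.vec set" where
  "row_span s A =
     {transpose_mat (mat_of_rows s rs) *\<^sub>v c | rs c. set rs \<subseteq> A \<and> c \<in> carrier_vec (length rs)}"

definition is_presentation_matrix ::
    "('l::comm_ring_1, 'x) module \<Rightarrow> nat \<Rightarrow> 'l Matrix.vec set \<Rightarrow> bool" where
  "is_presentation_matrix M s A \<longleftrightarrow> A \<subseteq> carrier_vec s \<and>
     (\<exists>e. e ` carrier_vec s = carrier M \<and>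
        (\<forall>u\<in>carrier_vec s. \<forall>v\<in>carrier_vec s. e (u + v) = e u \<oplus>\<^bsub>M\<^esub> e v) \<and>
        (\<forall>a. \<forall>u\<in>carrier_vec s. e (a \<cdot>\<^sub>v u) = a \<odot>\<^bsub>M\<^esub> e u) \<and>
        {u \<in> carrier_vec s. e u = \<zero>\<^bsub>M\<^esub>} = row_span s A)"

text \<open>The maximal minors are the minors of size the number \<open>s\<close> of columns. Lists \<open>rs\<close> with a
  repetition only contribute the minor \<open>0\<close>; with fewer than \<open>s\<close> rows the greatest common divisor
  is \<open>0\<close>, and for \<open>s = 0\<close> the only minor is the empty one, which is \<open>1\<close>.\<close>

definition maximal_minors :: "nat \<Rightarrow> 'l::comm_ring_1 Matrix.vec set \<Rightarrow> 'l set" where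
  "maximal_minors s A = {Determinant.det (mat_of_rows s rs) | rs. length rs = s \<and> set rs \<subseteq> A}"

definition is_greatest_common_divisor :: "'l::comm_semiring_1 set \<Rightarrow> 'l \<Rightarrow> bool" where
  "is_greatest_common_divisor S d \<longleftrightarrow>
     (\<forall>x\<in>S. d dvd x) \<and> (\<forall>d'. (\<forall>x\<in>S. d' dvd x) \<longrightarrow> d' dvd d)"

definition is_order_of_module :: "('l::comm_ring_1, 'x) module \<Rightarrow> 'l \<Rightarrow> bool" where
  "is_order_of_module M d \<longleftrightarrow>
     (\<exists>s A. is_presentation_matrix M s A \<and> is_greatest_common_divisor (maximal_minors s A) d)"


section \<open>Twisted Alexander polynomials and twisted Reidemeister torsion\<close>

text \<open>Laurent polynomials form the group ring of the integers: the product of \<open>poly_mapping\<close> is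
  convolution and \<open>single m a\<close> is the monomial \<open>a t^m\<close>.\<close>

type_synonym 'a laurent = "int \<Rightarrow>\<^sub>0 'a"

definition GL :: "('a::comm_ring_1 ^ 'k ^ 'k) monoid" where
  "GL = \<lparr>carrier = {A. invertible A}, monoid.mult = (**), one = Finite_Cartesian_Product.mat 1\<rparr>"

definition twisted_action ::
    "('g \<Rightarrow> int) \<Rightarrow> ('g \<Rightarrow> 'a::comm_ring_1 ^ 'k ^ 'k) \<Rightarrow> 'g \<Rightarrow> 'a laurent ^ 'k \<Rightarrow> 'a laurent ^ 'k"
  where
  "twisted_action \<phi> \<rho> g v =
     Poly_Mapping.single (\<phi> g) 1 *s (map_matrix (Poly_Mapping.single 0) (\<rho> g) *v v)"

definition twisted_homology ::
    "('g, 'z) monoid_scheme \<Rightarrow> ('g \<Rightarrow> int) \<Rightarrow> ('g \<Rightarrow> 'a::comm_ring_1 ^ 'k ^ 'k) \<Rightarrow> nat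
      \<Rightarrow> ('a laurent, ('g list \<Rightarrow>\<^sub>0 'a laurent ^ 'k) set) module" where
  "twisted_homology G \<phi> \<rho> i = group_homology G (*s) (twisted_action \<phi> \<rho>) i"

text \<open>Twisted Alexander polynomials are only defined up to units, and twisted torsion only up to
  monomial factors; the following two predicates describe all their representatives.\<close>

definition is_twisted_alexander_polynomial ::
    "('g, 'z) monoid_scheme \<Rightarrow> ('g \<Rightarrow> int) \<Rightarrow> ('g \<Rightarrow> 'a::comm_ring_1 ^ 'k ^ 'k) \<Rightarrow> nat
      \<Rightarrow> 'a laurent \<Rightarrow> bool" where
  "is_twisted_alexander_polynomial G \<phi> \<rho> i \<Delta> \<longleftrightarrow> is_order_of_module (twisted_homology G \<phi> \<rho> i) \<Delta>"

text \<open>Both sides live in \<open>'a laurent fract\<close>, the field of rational functions over the fraction field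
  of \<open>'a\<close>. The monomial factor is \<open>(a / b) t^m\<close>.\<close>

definition eq_up_to_monomial :: "'a::idom laurent fract \<Rightarrow> 'a laurent fract \<Rightarrow> bool"
    (infix \<open>\<doteq>\<close> 50) where
  "x \<doteq> y \<longleftrightarrow> (\<exists>a b m. a \<noteq> 0 \<and> b \<noteq> 0 \<and>
     x = to_fract (Poly_Mapping.single m a) / to_fract (Poly_Mapping.single 0 b) * y)"

text \<open>The product over all degrees makes sense for representatives almost all of which are \<open>1\<close>.\<close>

definition is_twisted_reidemeister_torsion ::
    "('g, 'z) monoid_scheme \<Rightarrow> ('g \<Rightarrow> int) \<Rightarrow> ('g \<Rightarrow> 'a::idom ^ 'k ^ 'k)
      \<Rightarrow> 'a laurent fract \<Rightarrow> bool" where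
  "is_twisted_reidemeister_torsion G \<phi> \<rho> \<tau> \<longleftrightarrow>
     (\<exists>\<Delta>. (\<forall>i. is_twisted_alexander_polynomial G \<phi> \<rho> i (\<Delta> i)) \<and> finite {i. \<Delta> i \<noteq> 1} \<and>
        \<tau> \<doteq> (\<Prod>i | \<Delta> i \<noteq> 1. to_fract (\<Delta> i) powi ((-1) ^ (i + 1))))"

end

theory Submission
  imports Defs
begin

text \<open>The Laurent module \<open>R\<^sup>k[t\<^sup>\<plusminus>\<^sup>1]\<close> is induced from the free group \<open>F = ker \<phi>\<close>, so by Shapiro's lemma
  \<open>H\<^sub>i(G; R\<^sup>k[t\<^sup>\<plusminus>\<^sup>1]) = H\<^sub>i(F; R\<^sup>k)\<close>, which vanishes for \<open>i \<ge> 2\<close>. On bar chains: prepending to a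
  chain of total \<open>t\<close>-degree \<open>q\<close> an element of degree \<open>- q\<close> moves a cycle, up to a boundary, into the
  span of the elements \<open>f c - c\<close> with \<open>f \<in> F\<close>. As the augmentation ideal of \<open>F\<close> is free on the
  elements \<open>x - 1\<close> for \<open>x\<close> in a basis, such a cycle has the form \<open>\<Sum>x. x c\<^sub>x - c\<^sub>x\<close> where each \<open>c\<^sub>x\<close> is
  annihilated by all faces except the first one, and prepending \<open>x\<close> to \<open>c\<^sub>x\<close> bounds it. Hence the Alexander
  polynomials of degree at least two are units, i.e. monomials; all orders are unique up to units by
  Fitting's lemma.\<close>

section \<open>The bar complex\<close>

text \<open>Homology is defined by the full bar complex of G, so the resolution of length one of a
  free group has to be found inside bar chains. To this end the first letter of a tuple is read as a
  group ring coefficient. Chains of degree n then form the degree n - 1 part of the bar resolution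
  of the coefficient module: all faces but the first give its differential up to sign, multiplying
  the first letter from the left is the action of G, and the first face is the passage to
  coinvariants.

  Normalising the total degree to 0 is Shapiro's lemma in this picture: in total degree 0 the degree
  of the first letter is determined by the rest of the chain, so coinvariants under G become
  coinvariants under the kernel.

  Nothing is computed in degrees 0 and 1. There the given polynomials only have to be compared with
  other representatives, which is why an order must not depend on the presentation that it was read
  off from.\<close>

definition additive_extension :: "('b \<Rightarrow> 'm::zero \<Rightarrow> 'n::comm_monoid_add) \<Rightarrow> ('b \<Rightarrow>\<^sub>0 'm) \<Rightarrow> 'n" where
  "additive_extension f c = (\<Sum>b\<in>Poly_Mapping.keys c. f b (Poly_Mapping.lookup c b))"

lemma additive_extension_single [simp]:
  "f b 0 = 0 \<Longrightarrow> additive_extension f (Poly_Mapping.single b m) = f b m"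
  by (cases "m = 0") (auto simp: additive_extension_def)

lemma additive_extension_superset:
  assumes "finite B" "Poly_Mapping.keys c \<subseteq> B" "\<And>b. f b 0 = 0"
  shows "additive_extension f c = (\<Sum>b\<in>B. f b (Poly_Mapping.lookup c b))"
  unfolding additive_extension_def
  by (rule sum.mono_neutral_left) (use assms in \<open>auto simp: in_keys_iff\<close>)

lemma additive_additive_extension:
  fixes f :: "'b \<Rightarrow> 'm::ab_group_add \<Rightarrow> 'n::ab_group_add"
  assumes "\<And>b. Modules.additive (f b)"
  shows "Modules.additive (additive_extension f)"
proof
  fix c d :: "'b \<Rightarrow>\<^sub>0 'm"
  let ?B = "Poly_Mapping.keys c \<union> Poly_Mapping.keys d"
  have f0: "f b 0 = 0" for b
    using assms by (rule Modules.additive.zero)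
  have "additive_extension f (c + d) = (\<Sum>b\<in>?B. f b (Poly_Mapping.lookup (c + d) b))"
    by (rule additive_extension_superset) (use Poly_Mapping.keys_add[of c d] f0 in auto)
  also have "\<dots> = (\<Sum>b\<in>?B. f b (Poly_Mapping.lookup c b)) + (\<Sum>b\<in>?B. f b (Poly_Mapping.lookup d b))"
    using Modules.additive.add[OF assms] by (simp add: lookup_add sum.distrib)
  also have "\<dots> = additive_extension f c + additive_extension f d"
    using f0 by (simp add: additive_extension_superset[where B = ?B])
  finally show "additive_extension f (c + d) = additive_extension f c + additive_extension f d" .
qed

lemma sum_single_lookup:
  "(\<Sum>b\<in>Poly_Mapping.keys c. Poly_Mapping.single b (Poly_Mapping.lookup c b)) = c"
  by (rule poly_mapping_eqI)
     (auto simp: lookup_sum lookup_single when_def in_keys_iff sum.delta)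

text \<open>A finitely supported function is the sum of its singles. Agreement is demanded only on
  the singles that occur in \<open>c\<close>, so identities that hold merely for tuples of one
  length with entries in G can be checked this way.\<close>

lemma additive_eqI:
  assumes "Modules.additive S" "Modules.additive T"
    and "\<And>b. b \<in> Poly_Mapping.keys c \<Longrightarrow>
      S (Poly_Mapping.single b (Poly_Mapping.lookup c b)) = T (Poly_Mapping.single b (Poly_Mapping.lookup c b))"
  shows "S c = T c"
  using assms(3) Modules.additive.sum[OF assms(1), of "\<lambda>b. Poly_Mapping.single b (Poly_Mapping.lookup c b)" "Poly_Mapping.keys c"]
    Modules.additive.sum[OF assms(2), of "\<lambda>b. Poly_Mapping.single b (Poly_Mapping.lookup c b)" "Poly_Mapping.keys c"]
  by (simp add: sum_single_lookup)

lemma additive_compose: "Modules.additive S \<Longrightarrow> Modules.additive T \<Longrightarrow> Modules.additive (\<lambda>x. S (T x))"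
  by (simp add: Modules.additive_def)

lemma additive_plus: "Modules.additive S \<Longrightarrow> Modules.additive T \<Longrightarrow> Modules.additive (\<lambda>x. S x + T x)"
  by (simp add: Modules.additive_def algebra_simps)

lemma additive_diff: "Modules.additive S \<Longrightarrow> Modules.additive T \<Longrightarrow> Modules.additive (\<lambda>x. S x - T x)"
  by (simp add: Modules.additive_def algebra_simps)

lemma additive_minus: "Modules.additive S \<Longrightarrow> Modules.additive (\<lambda>x. - S x)"
  by (simp add: Modules.additive_def algebra_simps)

lemma additive_id: "Modules.additive (\<lambda>x. x)"
  by (simp add: Modules.additive_def)

lemma additive_zero: "Modules.additive (\<lambda>x. 0)"
  by (simp add: Modules.additive_def)

lemma additive_single: "Modules.additive (Poly_Mapping.single b)"
  by (simp add: Modules.additive_def single_add)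

locale bar_complex = group G for G :: "('g, 'z) monoid_scheme" (structure) +
  fixes act :: "'g \<Rightarrow> 'm::ab_group_add \<Rightarrow> 'm"
  assumes additive_act: "Modules.additive (act g)"
    and act_mult: "g \<in> carrier G \<Longrightarrow> h \<in> carrier G \<Longrightarrow> act (g \<otimes> h) m = act g (act h m)"
begin

definition first_face :: "('g list \<Rightarrow>\<^sub>0 'm) \<Rightarrow> ('g list \<Rightarrow>\<^sub>0 'm)" where
  "first_face = additive_extension (\<lambda>gs m. if gs = [] then 0 else Poly_Mapping.single (tl gs) m)"

text \<open>With [g1|...|gn] \<otimes> m read as g1 times [g2|...|gn] \<otimes> m, this is minus the
  differential of the bar resolution of the coefficient module. On tuples of length one it is minus
  the augmentation, sending g \<otimes> m to g m.\<close>

definition upper_boundary :: "('g list \<Rightarrow>\<^sub>0 'm) \<Rightarrow> ('g list \<Rightarrow>\<^sub>0 'm)" where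
  "upper_boundary = additive_extension (\<lambda>gs m. \<Sum>i=1..length gs.
     if even i then bar_face G act i gs m else - bar_face G act i gs m)"

definition prepend :: "'g \<Rightarrow> ('g list \<Rightarrow>\<^sub>0 'm) \<Rightarrow> ('g list \<Rightarrow>\<^sub>0 'm)" where
  "prepend g = additive_extension (\<lambda>gs m. Poly_Mapping.single (g # gs) m)"

text \<open>The action of G on the bar resolution. The empty tuple has no first letter to multiply;
  the value 0 there is a default, and the laws of an action are only claimed for chains of positive
  degree.\<close>

definition translate :: "'g \<Rightarrow> ('g list \<Rightarrow>\<^sub>0 'm) \<Rightarrow> ('g list \<Rightarrow>\<^sub>0 'm)" where
  "translate g = additive_extension (\<lambda>gs m.
     if gs = [] then 0 else Poly_Mapping.single ((g \<otimes> hd gs) # tl gs) m)"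

lemma act_zero [simp]: "act g 0 = 0"
  using additive_act by (rule Modules.additive.zero)

lemma additive_bar_face: "Modules.additive (bar_face G act i gs)"
  by (auto simp: Modules.additive_def bar_face_def single_add Modules.additive.add[OF additive_act])

lemma bar_face_zero [simp]: "bar_face G act i gs 0 = 0"
  using additive_bar_face by (rule Modules.additive.zero)

lemma additive_first_face: "Modules.additive first_face"
  and additive_upper_boundary: "Modules.additive upper_boundary"
  and additive_prepend: "Modules.additive (prepend g)"
  and additive_translate: "Modules.additive (translate g)"
  unfolding first_face_def upper_boundary_def prepend_def translate_def
  by (intro additive_additive_extension; 
      auto simp: Modules.additive_def single_add sum.distrib Modules.additive.add[OF additive_bar_face]
        intro!: sum.cong simp flip: sum.distrib)+

lemma bar_boundary_eq: "bar_boundary G act c = first_face c + upper_boundary c"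
proof -
  have "(if gs = [] then 0 else \<Sum>i\<le>length gs.
        if even i then bar_face G act i gs m else - bar_face G act i gs m) =
      (if gs = [] then 0 else Poly_Mapping.single (tl gs) m) +
      (\<Sum>i=1..length gs. if even i then bar_face G act i gs m else - bar_face G act i gs m)" for gs m
  proof (cases "gs = []")
    case False
    then show ?thesis
      by (simp add: atMost_atLeast0 sum.atLeast_Suc_atMost bar_face_def)
  qed simp
  then show ?thesis
    by (simp add: bar_boundary_def first_face_def upper_boundary_def additive_extension_def flip: sum.distrib)
qed

lemma additive_bar_boundary: "Modules.additive (bar_boundary G act)"
  unfolding bar_boundary_eq[abs_def]
  by (intro additive_plus additive_first_face additive_upper_boundary)

lemmas additive_operators = additive_first_face additive_upper_boundary additive_prepend
  additive_translate additive_bar_boundary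

lemma first_face_single: "gs \<noteq> [] \<Longrightarrow> first_face (Poly_Mapping.single gs m) = Poly_Mapping.single (tl gs) m"
  by (simp add: first_face_def)

lemma prepend_single: "prepend g (Poly_Mapping.single gs m) = Poly_Mapping.single (g # gs) m"
  by (simp add: prepend_def)

lemma translate_single:
  "translate g (Poly_Mapping.single (h # gs) m) = Poly_Mapping.single ((g \<otimes> h) # gs) m"
  by (simp add: translate_def)

lemma upper_boundary_single:
  "upper_boundary (Poly_Mapping.single gs m) =
     (\<Sum>i=1..length gs. if even i then bar_face G act i gs m else - bar_face G act i gs m)"
  unfolding upper_boundary_def by (rule additive_extension_single) (simp add: sum.neutral)

lemma upper_boundary_single_one:
  "upper_boundary (Poly_Mapping.single [g] m) = - Poly_Mapping.single [] (act g m)"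
  by (simp add: upper_boundary_single bar_face_def)

lemma bar_face_Cons_Suc:
  assumes "1 \<le> i"
  shows "bar_face G act (Suc i) (g # gs) m = prepend g (bar_face G act i gs m)"
  using assms by (cases i) (auto simp: bar_face_def prepend_single nth_Cons' take_Cons')

text \<open>The first of the upper faces merges \<open>g\<close> into the head of \<open>gs\<close>.
  The others leave \<open>g\<close> alone and are the upper faces of \<open>gs\<close> with indices
  shifted by one, hence with the opposite sign. The later identities for
  \<open>upper_boundary\<close> rest on this recursion.\<close>

lemma upper_boundary_single_Cons:
  assumes "gs \<noteq> []"
  shows "upper_boundary (Poly_Mapping.single (g # gs) m) =
    - translate g (Poly_Mapping.single gs m) - prepend g (upper_boundary (Poly_Mapping.single gs m))"
proof -
  let ?f = "\<lambda>gs i. if even i then bar_face G act i gs m else - bar_face G act i gs m"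
  have "upper_boundary (Poly_Mapping.single (g # gs) m) = ?f (g # gs) 1 + (\<Sum>i=1..length gs. ?f (g # gs) (Suc i))"
    by (simp add: upper_boundary_single sum.atLeast_Suc_atMost sum.shift_bounds_cl_Suc_ivl del: sum.cl_ivl_Suc)
  also have "?f (g # gs) 1 = - translate g (Poly_Mapping.single gs m)"
    using assms by (cases gs) (auto simp: bar_face_def translate_single)
  also have "(\<Sum>i=1..length gs. ?f (g # gs) (Suc i)) = (\<Sum>i=1..length gs. - prepend g (?f gs i))"
    by (rule sum.cong) (auto simp: bar_face_Cons_Suc Modules.additive.minus[OF additive_prepend])
  also have "\<dots> = - prepend g (upper_boundary (Poly_Mapping.single gs m))"
    by (simp add: upper_boundary_single Modules.additive.sum[OF additive_prepend] sum_negf)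
  finally show ?thesis by simp
qed

section \<open>Chains of a fixed degree\<close>

lemma zero_in_bar_chains: "0 \<in> bar_chains G n"
  by (simp add: bar_chains_def)

lemma single_in_bar_chains:
  "length gs = n \<Longrightarrow> set gs \<subseteq> carrier G \<Longrightarrow> Poly_Mapping.single gs m \<in> bar_chains G n"
  by (simp add: bar_chains_def)

lemma add_in_bar_chains: "c \<in> bar_chains G n \<Longrightarrow> d \<in> bar_chains G n \<Longrightarrow> c + d \<in> bar_chains G n"
  using Poly_Mapping.keys_add[of c d] by (auto simp: bar_chains_def)

lemma uminus_in_bar_chains: "c \<in> bar_chains G n \<Longrightarrow> - c \<in> bar_chains G n"
  by (simp add: bar_chains_def)

lemma sum_in_bar_chains: "(\<And>i. i \<in> I \<Longrightarrow> c i \<in> bar_chains G n) \<Longrightarrow> sum c I \<in> bar_chains G n"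
  by (induction I rule: infinite_finite_induct) (auto simp: zero_in_bar_chains add_in_bar_chains)

lemma additive_extension_in_bar_chains:
  assumes "c \<in> bar_chains G n"
    and "\<And>gs m. length gs = n \<Longrightarrow> set gs \<subseteq> carrier G \<Longrightarrow> f gs m \<in> bar_chains G k"
  shows "additive_extension f c \<in> bar_chains G k"
  unfolding additive_extension_def
  by (intro sum_in_bar_chains assms(2)) (use assms(1) in \<open>auto simp: bar_chains_def\<close>)

lemma bar_face_in_bar_chains:
  assumes "length gs = Suc n" "set gs \<subseteq> carrier G" "i \<le> Suc n"
  shows "bar_face G act i gs m \<in> bar_chains G n"
proof -
  have "gs ! j \<in> carrier G" if "j < Suc n" for j
    using assms that nth_mem by fastforce
  moreover have "x \<in> carrier G" if "x \<in> set (take j gs)" for x j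
    using that assms(2) in_set_takeD by fast
  moreover have "x \<in> carrier G" if "x \<in> set (drop j gs)" for x j
    using that assms(2) in_set_dropD by fast
  ultimately show ?thesis
    using assms(1,3) subsetD[OF assms(2)] unfolding bar_face_def
    by (auto intro!: single_in_bar_chains dest: in_set_butlastD list.set_sel(2)[rotated])
qed

lemma first_face_in_bar_chains: "c \<in> bar_chains G (Suc n) \<Longrightarrow> first_face c \<in> bar_chains G n"
  unfolding first_face_def
  by (erule additive_extension_in_bar_chains)
     (auto intro!: single_in_bar_chains dest: list.set_sel(2)[rotated] simp: zero_in_bar_chains)

lemma upper_boundary_in_bar_chains: "c \<in> bar_chains G (Suc n) \<Longrightarrow> upper_boundary c \<in> bar_chains G n"
  unfolding upper_boundary_def
  by (erule additive_extension_in_bar_chains, rule sum_in_bar_chains)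
     (auto intro!: uminus_in_bar_chains bar_face_in_bar_chains)

lemma prepend_in_bar_chains:
  "g \<in> carrier G \<Longrightarrow> c \<in> bar_chains G n \<Longrightarrow> prepend g c \<in> bar_chains G (Suc n)"
  unfolding prepend_def
  by (erule additive_extension_in_bar_chains) (auto intro!: single_in_bar_chains)

lemma translate_in_bar_chains:
  "g \<in> carrier G \<Longrightarrow> c \<in> bar_chains G n \<Longrightarrow> translate g c \<in> bar_chains G n"
  unfolding translate_def
  apply (erule additive_extension_in_bar_chains)
  subgoal for gs m
    by (cases gs) (auto intro!: single_in_bar_chains simp: zero_in_bar_chains)
  done

lemma additive_eq_on_bar_chains:
  assumes "c \<in> bar_chains G n" "Modules.additive S" "Modules.additive T"
    and "\<And>gs m. length gs = n \<Longrightarrow> set gs \<subseteq> carrier G \<Longrightarrow>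
      S (Poly_Mapping.single gs m) = T (Poly_Mapping.single gs m)"
  shows "S c = T c"
  by (rule additive_eqI[OF assms(2,3)], rule assms(4)) (use assms(1) in \<open>auto simp: bar_chains_def\<close>)

lemma upper_boundary_prepend:
  assumes "c \<in> bar_chains G (Suc n)"
  shows "upper_boundary (prepend g c) = - translate g c - prepend g (upper_boundary c)"
proof (rule additive_eq_on_bar_chains[OF assms])
  fix gs :: "'g list" and m assume "length gs = Suc n"
  then have "gs \<noteq> []" by auto
  then show "upper_boundary (prepend g (Poly_Mapping.single gs m)) =
      - translate g (Poly_Mapping.single gs m) - prepend g (upper_boundary (Poly_Mapping.single gs m))"
    by (simp add: prepend_single upper_boundary_single_Cons)
qed (auto intro!: additive_operators additive_diff additive_minus additive_compose[where S = upper_boundary]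
        additive_compose[where S = "prepend _"])

lemma first_face_prepend: "first_face (prepend g c) = c"
  by (rule additive_eqI[OF additive_compose additive_id])
     (auto intro!: additive_operators simp: prepend_single first_face_single)

text \<open>The first face removes the new letter and returns \<open>c\<close>; the next one merges
  it into the head. If \<open>upper_boundary c\<close> vanishes, prepending \<open>g\<close>
  therefore bounds the difference of \<open>c\<close> and its translate, which is how cycles are
  filled at the end.\<close>

lemma bar_boundary_prepend:
  assumes "c \<in> bar_chains G (Suc n)"
  shows "bar_boundary G act (prepend g c) = c - translate g c - prepend g (upper_boundary c)"
  using upper_boundary_prepend[OF assms] by (simp add: bar_boundary_eq first_face_prepend)

lemma first_face_translate:
  assumes "c \<in> bar_chains G (Suc n)"
  shows "first_face (translate g c) = first_face c"
proof (rule additive_eq_on_bar_chains[OF assms])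
  fix gs :: "'g list" and m assume "length gs = Suc n"
  then show "first_face (translate g (Poly_Mapping.single gs m)) = first_face (Poly_Mapping.single gs m)"
    by (cases gs) (auto simp: translate_single first_face_single)
qed (auto intro!: additive_operators additive_compose[where S = first_face])

lemma translate_prepend:
  "translate g (prepend h c) = prepend (g \<otimes> h) c"
  by (rule additive_eqI)
     (auto intro!: additive_operators additive_compose[where S = "translate _"] simp: prepend_single translate_single)

lemma translate_translate:
  assumes "c \<in> bar_chains G (Suc n)" "g \<in> carrier G" "h \<in> carrier G"
  shows "translate g (translate h c) = translate (g \<otimes> h) c"
proof (rule additive_eq_on_bar_chains[OF assms(1)])
  fix gs :: "'g list" and m assume "length gs = Suc n" "set gs \<subseteq> carrier G"
  then show "translate g (translate h (Poly_Mapping.single gs m)) = translate (g \<otimes> h) (Poly_Mapping.single gs m)"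
    using assms by (cases gs) (auto simp: translate_single m_assoc)
qed (auto intro!: additive_operators additive_compose[where S = "translate _"])

lemma translate_one:
  assumes "c \<in> bar_chains G (Suc n)"
  shows "translate \<one> c = c"
proof (rule additive_eq_on_bar_chains[OF assms(1)])
  fix gs :: "'g list" and m assume "length gs = Suc n" "set gs \<subseteq> carrier G"
  then show "translate \<one> (Poly_Mapping.single gs m) = Poly_Mapping.single gs m"
    by (cases gs) (auto simp: translate_single)
qed (auto intro!: additive_operators additive_id)

lemma upper_boundary_translate:
  assumes "c \<in> bar_chains G (Suc (Suc n))" "g \<in> carrier G"
  shows "upper_boundary (translate g c) = translate g (upper_boundary c)"
proof (rule additive_eq_on_bar_chains[OF assms(1)])
  fix gs :: "'g list" and m assume "length gs = Suc (Suc n)" and gs: "set gs \<subseteq> carrier G"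
  then obtain a b ks where "gs = a # b # ks"
    by (auto simp: length_Suc_conv)
  then show "upper_boundary (translate g (Poly_Mapping.single gs m)) =
      translate g (upper_boundary (Poly_Mapping.single gs m))"
    using assms gs
    by (simp add: translate_single upper_boundary_single_Cons m_assoc translate_prepend
        Modules.additive.diff[OF additive_translate] Modules.additive.minus[OF additive_translate])
qed (auto intro!: additive_operators additive_compose[where S = "translate _"] additive_compose[where S = upper_boundary])

lemma upper_boundary_upper_boundary:
  assumes "c \<in> bar_chains G (Suc n)"
  shows "upper_boundary (upper_boundary c) = 0"
proof -
  have *: "upper_boundary (upper_boundary (Poly_Mapping.single gs m)) = 0"
    if "length gs = Suc n" "set gs \<subseteq> carrier G" for gs m n
    using that
  proof (induction gs arbitrary: n)
    case (Cons a gs)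
    show ?case
    proof (cases gs)
      case Nil
      then show ?thesis
        by (simp add: upper_boundary_single_one Modules.additive.minus[OF additive_upper_boundary])
          (simp add: upper_boundary_single)
    next
      case gs: (Cons b ks)
      then have ne: "gs \<noteq> []" and "\<exists>k. length gs = Suc k" by auto
      then obtain k where k: "length gs = Suc k" by blast
      have c: "Poly_Mapping.single gs m \<in> bar_chains G (Suc k)"
        using Cons.prems k by (auto intro: single_in_bar_chains)
      have *: "upper_boundary (upper_boundary (Poly_Mapping.single (a # gs) m)) =
          - upper_boundary (translate a (Poly_Mapping.single gs m)) - upper_boundary (prepend a (upper_boundary (Poly_Mapping.single gs m)))"
        by (simp add: upper_boundary_single_Cons[OF ne] Modules.additive.diff[OF additive_upper_boundary]
            Modules.additive.minus[OF additive_upper_boundary])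
      show ?thesis
      \<comment> \<open>Tuples of length two stand apart, because \<open>translate\<close> does not
        describe the action on multiples of the empty tuple. The two remaining terms carry
        \<open>act (a \<otimes> b) m\<close> and \<open>act a (act b m)\<close> and cancel by
        \<open>act_mult\<close>. For longer tuples equivariance and the induction hypothesis
        apply.\<close>
      proof (cases ks)
        case Nil
        then show ?thesis
          using Cons.prems gs unfolding *
          by (simp add: upper_boundary_single_one translate_single prepend_single act_mult
              Modules.additive.minus[OF additive_upper_boundary] Modules.additive.minus[OF additive_prepend])
      next
        case (Cons b' ks')
        then obtain k' where k': "k = Suc k'" using k gs by auto
        have "upper_boundary (upper_boundary (Poly_Mapping.single gs m)) = 0"
          using Cons.IH[of k] Cons.prems k by simp
        then show ?thesis
          using Cons.prems c unfolding *
          by (simp add: k' upper_boundary_translate[of _ k']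
              upper_boundary_prepend[OF upper_boundary_in_bar_chains]
              Modules.additive.zero[OF additive_prepend])
      qed
    qed
  qed simp
  show ?thesis
    by (rule additive_eq_on_bar_chains[OF assms])
      (auto intro!: additive_operators additive_zero additive_compose[where S = upper_boundary] *)
qed

text \<open>After one application of the boundary, \<open>c\<close> and its translate have equal
  first faces, and their upper boundaries differ by exactly what the last term contributes. Lifts of
  chains are sums of prepended ones, so this case of the vanishing square is the one that
  matters.\<close>

lemma bar_boundary_bar_boundary_prepend:
  assumes "c \<in> bar_chains G (Suc (Suc n))" "g \<in> carrier G"
  shows "bar_boundary G act (bar_boundary G act (prepend g c)) = 0"
proof -
  have "bar_boundary G act (bar_boundary G act (prepend g c)) =
      bar_boundary G act c - bar_boundary G act (translate g c) - bar_boundary G act (prepend g (upper_boundary c))"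
    using assms by (simp add: bar_boundary_prepend Modules.additive.diff[OF additive_bar_boundary])
  also have "bar_boundary G act (prepend g (upper_boundary c)) = upper_boundary c - translate g (upper_boundary c)"
    using bar_boundary_prepend[OF upper_boundary_in_bar_chains[OF assms(1)]] upper_boundary_upper_boundary[OF assms(1)]
    by (simp add: Modules.additive.zero[OF additive_prepend])
  finally show ?thesis
    using assms by (simp add: bar_boundary_eq first_face_translate upper_boundary_translate)
qed

end


section \<open>Graded coefficients\<close>

text \<open>The properties of G and of the Laurent module that enter the argument. The map
  \<open>\<sigma>\<close> picks a letter of each degree, with reversed sign since it has to cancel a
  given degree. In \<open>basis_independent\<close>, \<open>d x\<close> is an element of the group
  ring with coefficients in the module and the summand is the coefficient of x d_x - d_x at
  \<open>v\<close>: the elements x - 1 for \<open>x\<close> in \<open>X\<close> are linearly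
  independent.\<close>

locale graded_bar_complex = bar_complex G act
  for G :: "('g, 'z) monoid_scheme" (structure) and act :: "'g \<Rightarrow> 'm::ab_group_add \<Rightarrow> 'm" +
  fixes \<phi> :: "'g \<Rightarrow> int" and proj :: "int \<Rightarrow> 'm \<Rightarrow> 'm" and \<sigma> :: "int \<Rightarrow> 'g" and X :: "'g set"
  assumes degree_mult: "g \<in> carrier G \<Longrightarrow> h \<in> carrier G \<Longrightarrow> \<phi> (g \<otimes> h) = \<phi> g + \<phi> h"
    and additive_proj: "Modules.additive (proj q)"
    and finite_proj: "finite {q. proj q m \<noteq> 0}"
    and sum_proj: "(\<Sum>q | proj q m \<noteq> 0. proj q m) = m"
    and proj_proj: "proj p (proj q m) = (if p = q then proj q m else 0)"
    and proj_act: "g \<in> carrier G \<Longrightarrow> proj (q + \<phi> g) (act g m) = act g (proj q m)"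
    and section_closed: "\<sigma> q \<in> carrier G" and degree_section: "\<phi> (\<sigma> q) = - q"
    and finite_basis: "finite X" and basis_closed: "X \<subseteq> carrier G"
    and kernel_generated: "g \<in> carrier G \<Longrightarrow> \<phi> g = 0 \<Longrightarrow> g \<in> generate G X"
    and basis_independent:
      "(\<And>x. x \<in> X \<Longrightarrow> finite {v. d x v \<noteq> (0::'m)}) \<Longrightarrow>
       (\<And>v. v \<in> carrier G \<Longrightarrow> (\<Sum>x\<in>X. d x (inv x \<otimes> v) - d x v) = 0) \<Longrightarrow>
       x \<in> X \<Longrightarrow> v \<in> carrier G \<Longrightarrow> d x v = 0"
begin

definition word_degree :: "'g list \<Rightarrow> int" where
  "word_degree gs = sum_list (map \<phi> gs)"

text \<open>For \<open>m\<close> homogeneous of degree \<open>q\<close> the total degree is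
  \<open>q + word_degree gs\<close>. The prepended letter has the negative of this degree, so every
  lifted summand has total degree 0. \<open>Sum_any\<close> ranges over all degrees, of which only
  finitely many contribute.\<close>

definition lift :: "('g list \<Rightarrow>\<^sub>0 'm) \<Rightarrow> ('g list \<Rightarrow>\<^sub>0 'm)" where
  "lift = additive_extension (\<lambda>gs m. Sum_any (\<lambda>q.
     Poly_Mapping.single (\<sigma> (q + word_degree gs) # gs) (proj q m)))"

text \<open>The face of \<open>lift\<close> that merges the new letter into the head. It moves each
  tuple of positive length to total degree 0 without touching its tail.\<close>

definition straighten :: "('g list \<Rightarrow>\<^sub>0 'm) \<Rightarrow> ('g list \<Rightarrow>\<^sub>0 'm)" where
  "straighten = additive_extension (\<lambda>gs m. Sum_any (\<lambda>q.
     translate (\<sigma> (q + word_degree gs)) (Poly_Mapping.single gs (proj q m))))"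

lemma proj_zero [simp]: "proj q 0 = 0"
  using additive_proj by (rule Modules.additive.zero)

lemma additive_Sum_any_proj:
  fixes T :: "int \<Rightarrow> 'm \<Rightarrow> 'c::ab_group_add"
  assumes "\<And>q. Modules.additive (T q)"
  shows "Modules.additive (\<lambda>m. Sum_any (\<lambda>q. T q (proj q m)))"
proof
  fix m m' :: 'm
  have "finite {q. T q (proj q m) \<noteq> 0}" for m
    by (rule finite_subset[OF _ finite_proj[of m]]) (auto simp: Modules.additive.zero[OF assms])
  then show "Sum_any (\<lambda>q. T q (proj q (m + m'))) =
      Sum_any (\<lambda>q. T q (proj q m)) + Sum_any (\<lambda>q. T q (proj q m'))"
    by (simp add: Modules.additive.add[OF additive_proj] Modules.additive.add[OF assms] Sum_any.distrib)
qed

lemma Sum_any_proj_homogeneous: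
  fixes T :: "int \<Rightarrow> 'm \<Rightarrow> 'c::ab_group_add"
  assumes "\<And>q. Modules.additive (T q)" and "proj q m = m"
  shows "Sum_any (\<lambda>p. T p (proj p m)) = T q m"
proof -
  have "T p (proj p m) = (if p = q then T p m else 0)" for p
    using proj_proj[of p q m] assms(2) Modules.additive.zero[OF assms(1)] by auto
  then show ?thesis by (simp cong: Sum_any.cong)
qed

lemma additive_lift: "Modules.additive lift"
  unfolding lift_def
  by (intro additive_additive_extension additive_Sum_any_proj additive_single)

lemma additive_straighten: "Modules.additive straighten"
  unfolding straighten_def
  by (intro additive_additive_extension additive_Sum_any_proj additive_compose[OF additive_translate additive_single])

lemma lift_single:
  assumes "proj q m = m"
  shows "lift (Poly_Mapping.single gs m) = prepend (\<sigma> (q + word_degree gs)) (Poly_Mapping.single gs m)"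
proof -
  have "lift (Poly_Mapping.single gs m) =
      Sum_any (\<lambda>q. Poly_Mapping.single (\<sigma> (q + word_degree gs) # gs) (proj q m))"
    by (simp add: lift_def)
  also have "\<dots> = Poly_Mapping.single (\<sigma> (q + word_degree gs) # gs) m"
    using assms by (rule Sum_any_proj_homogeneous[OF additive_single])
  finally show ?thesis by (simp add: prepend_single)
qed

lemma straighten_single:
  assumes "proj q m = m"
  shows "straighten (Poly_Mapping.single gs m) = translate (\<sigma> (q + word_degree gs)) (Poly_Mapping.single gs m)"
proof -
  have "straighten (Poly_Mapping.single gs m) =
      Sum_any (\<lambda>q. translate (\<sigma> (q + word_degree gs)) (Poly_Mapping.single gs (proj q m)))"
    by (simp add: straighten_def Modules.additive.zero[OF additive_translate])
  also have "\<dots> = translate (\<sigma> (q + word_degree gs)) (Poly_Mapping.single gs m)"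
    using assms by (rule Sum_any_proj_homogeneous[OF additive_compose[OF additive_translate additive_single]])
  finally show ?thesis .
qed

text \<open>Each coefficient is the finite sum of its projections, and these are fixed by their own
  projection because the projections are idempotent.\<close>

lemma homogeneous_induct [consumes 1, case_names zero add single]:
  assumes "c \<in> bar_chains G n" and "P 0" and add: "\<And>a b. P a \<Longrightarrow> P b \<Longrightarrow> P (a + b)"
    and single: "\<And>gs q m. length gs = n \<Longrightarrow> set gs \<subseteq> carrier G \<Longrightarrow> proj q m = m \<Longrightarrow>
      P (Poly_Mapping.single gs m)"
  shows "P c"
proof -
  have sum: "P (\<Sum>i\<in>I. f i)" if "\<And>i. i \<in> I \<Longrightarrow> P (f i)" for I :: "'i set" and f
    using that by (induction I rule: infinite_finite_induct) (auto simp: \<open>P 0\<close> add)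
  have *: "P (Poly_Mapping.single gs m)" if "length gs = n" "set gs \<subseteq> carrier G" for gs m
  proof -
    have "Poly_Mapping.single gs m = (\<Sum>q | proj q m \<noteq> 0. Poly_Mapping.single gs (proj q m))"
      using Modules.additive.sum[OF additive_single, of gs "\<lambda>q. proj q m" "{q. proj q m \<noteq> 0}"] sum_proj[of m] by simp
    also have "P \<dots>"
      by (intro sum single that) (simp add: proj_proj)
    finally show ?thesis .
  qed
  have "P (\<Sum>gs\<in>Poly_Mapping.keys c. Poly_Mapping.single gs (Poly_Mapping.lookup c gs))"
    by (intro sum *) (use assms(1) in \<open>auto simp: bar_chains_def\<close>)
  then show ?thesis by (simp add: sum_single_lookup)
qed

lemma homogeneous_eqI:
  assumes "c \<in> bar_chains G n" and "Modules.additive S" "Modules.additive T"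
    and "\<And>gs q m. length gs = n \<Longrightarrow> set gs \<subseteq> carrier G \<Longrightarrow> proj q m = m \<Longrightarrow>
      S (Poly_Mapping.single gs m) = T (Poly_Mapping.single gs m)"
  shows "S c = T c"
  using assms(1)
  by (induction rule: homogeneous_induct)
     (simp_all add: assms(4) Modules.additive.zero[OF assms(2)] Modules.additive.zero[OF assms(3)]
        Modules.additive.add[OF assms(2)] Modules.additive.add[OF assms(3)])

lemma lift_in_bar_chains:
  assumes "c \<in> bar_chains G n"
  shows "lift c \<in> bar_chains G (Suc n)"
  using assms
  by (induction rule: homogeneous_induct)
     (simp_all add: Modules.additive.zero[OF additive_lift] Modules.additive.add[OF additive_lift]
        zero_in_bar_chains add_in_bar_chains lift_single prepend_in_bar_chains section_closed single_in_bar_chains)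

text \<open>Upper faces preserve the total degree. An inner face multiplies two neighbouring
  letters, and \<phi> is additive; the last face deletes a letter but lets it act on the
  coefficient, whose degree rises by the same amount. Hence the letter chosen for \<open>gs\<close>
  is also the one that the face calls for.\<close>

lemma lift_bar_face:
  assumes "proj q m = m" "set gs \<subseteq> carrier G" "1 \<le> i" "i \<le> length gs"
  shows "lift (bar_face G act i gs m) = prepend (\<sigma> (q + word_degree gs)) (bar_face G act i gs m)"
proof (cases "i = length gs")
  case True
  then have ne: "gs \<noteq> []" using assms(3) by auto
  have "last gs \<in> carrier G" using assms(2) ne by auto
  then have h: "proj (q + \<phi> (last gs)) (act (last gs) m) = act (last gs) m"
    using proj_act[of "last gs" q m] assms(1) by simp
  have "word_degree (butlast gs @ [last gs]) = word_degree (butlast gs) + \<phi> (last gs)"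
    unfolding word_degree_def by simp
  then have "word_degree gs = word_degree (butlast gs) + \<phi> (last gs)"
    using ne by simp
  then show ?thesis
    using True ne lift_single[OF h, of "butlast gs"] by (simp add: bar_face_def algebra_simps)
next
  case False
  let ?hs = "take (i - 1) gs @ [gs ! (i - 1) \<otimes> gs ! i] @ drop (i + 1) gs"
  have "gs ! (i - 1) \<in> carrier G" "gs ! i \<in> carrier G"
    using assms False by (auto intro!: subsetD[OF assms(2)] nth_mem)
  then have 1: "word_degree ?hs = word_degree (take (i - 1) gs @ gs ! (i - 1) # gs ! i # drop (i + 1) gs)"
    by (simp add: word_degree_def degree_mult)
  have "take (i - 1) gs @ gs ! (i - 1) # gs ! i # drop (i + 1) gs = gs"
    using assms False id_take_nth_drop[of "i - 1" gs] Cons_nth_drop_Suc[of i gs] by simp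
  then have "word_degree ?hs = word_degree gs" using 1 by simp
  then show ?thesis
    using False assms(3) lift_single[OF assms(1), of ?hs] by (simp add: bar_face_def)
qed

lemma lift_upper_boundary_single:
  assumes "proj q m = m" "set gs \<subseteq> carrier G"
  shows "lift (upper_boundary (Poly_Mapping.single gs m)) =
    prepend (\<sigma> (q + word_degree gs)) (upper_boundary (Poly_Mapping.single gs m))"
  unfolding upper_boundary_single Modules.additive.sum[OF additive_lift] Modules.additive.sum[OF additive_prepend]
  by (rule sum.cong)
     (use assms in \<open>auto simp: lift_bar_face Modules.additive.minus[OF additive_lift] Modules.additive.minus[OF additive_prepend]\<close>)

lemma bar_boundary_lift:
  assumes "c \<in> bar_chains G (Suc n)"
  shows "bar_boundary G act (lift c) = c - straighten c - lift (upper_boundary c)"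
proof (rule homogeneous_eqI[OF assms])
  fix gs :: "'g list" and q m
  assume "length gs = Suc n" "set gs \<subseteq> carrier G" "proj q m = m"
  then show "bar_boundary G act (lift (Poly_Mapping.single gs m)) = Poly_Mapping.single gs m
      - straighten (Poly_Mapping.single gs m) - lift (upper_boundary (Poly_Mapping.single gs m))"
    by (simp add: lift_single straighten_single lift_upper_boundary_single
        bar_boundary_prepend[OF single_in_bar_chains])
qed (auto intro!: additive_diff additive_id additive_operators additive_lift additive_straighten
      additive_compose[where S = "bar_boundary G act"] additive_compose[where S = lift])

lemma bar_boundary_bar_boundary_lift:
  assumes "c \<in> bar_chains G (Suc (Suc n))"
  shows "bar_boundary G act (bar_boundary G act (lift c)) = 0"
proof (rule homogeneous_eqI[OF assms])
  fix gs :: "'g list" and q m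
  assume "length gs = Suc (Suc n)" "set gs \<subseteq> carrier G" "proj q m = m"
  then show "bar_boundary G act (bar_boundary G act (lift (Poly_Mapping.single gs m))) = 0"
    by (simp add: lift_single section_closed bar_boundary_bar_boundary_prepend[OF single_in_bar_chains])
qed (auto intro!: additive_zero additive_operators additive_lift additive_compose[where S = "bar_boundary G act"])

lemma first_face_lift:
  assumes "c \<in> bar_chains G n"
  shows "first_face (lift c) = c"
proof (rule homogeneous_eqI[OF assms])
  fix gs :: "'g list" and q m
  assume "proj q m = m"
  then show "first_face (lift (Poly_Mapping.single gs m)) = Poly_Mapping.single gs m"
    by (simp add: lift_single first_face_prepend)
qed (auto intro!: additive_id additive_operators additive_lift additive_compose[where S = first_face])

lemma first_face_straighten:
  assumes "c \<in> bar_chains G (Suc n)"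
  shows "first_face (straighten c) = first_face c"
proof (rule homogeneous_eqI[OF assms])
  fix gs :: "'g list" and q m
  assume "proj q m = m" "length gs = Suc n" "set gs \<subseteq> carrier G"
  then show "first_face (straighten (Poly_Mapping.single gs m)) = first_face (Poly_Mapping.single gs m)"
    by (simp add: straighten_single first_face_translate[OF single_in_bar_chains])
qed (auto intro!: additive_operators additive_straighten additive_compose[where S = first_face])

text \<open>The augmentation ideal of the kernel times the chains. It is described by one chain for
  each basis element, and not by arbitrary kernel elements, because these chains are then uniquely
  determined and inherit equations from their sum.\<close>

definition coinvariant_relations :: "nat \<Rightarrow> ('g list \<Rightarrow>\<^sub>0 'm) set" where
  "coinvariant_relations n =
     {\<Sum>x\<in>X. translate x (e x) - e x | e. \<forall>x\<in>X. e x \<in> bar_chains G n}"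

lemma coinvariant_relations_zero: "0 \<in> coinvariant_relations n"
  unfolding coinvariant_relations_def
  by (rule CollectI, rule exI[of _ "\<lambda>_. 0"])
     (simp add: zero_in_bar_chains Modules.additive.zero[OF additive_translate])

lemma coinvariant_relations_add:
  assumes "a \<in> coinvariant_relations n" "b \<in> coinvariant_relations n"
  shows "a + b \<in> coinvariant_relations n"
proof -
  obtain e f where
    "a = (\<Sum>x\<in>X. translate x (e x) - e x)" "\<forall>x\<in>X. e x \<in> bar_chains G n"
    "b = (\<Sum>x\<in>X. translate x (f x) - f x)" "\<forall>x\<in>X. f x \<in> bar_chains G n"
    using assms by (auto simp: coinvariant_relations_def)
  then show ?thesis
    unfolding coinvariant_relations_def
    by (intro CollectI exI[of _ "\<lambda>x. e x + f x"])
       (auto simp: add_in_bar_chains Modules.additive.add[OF additive_translate] sum.distrib sum_subtractf)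
qed

lemma coinvariant_relations_basis:
  assumes "x \<in> X" "c \<in> bar_chains G n"
  shows "translate x c - c \<in> coinvariant_relations n"
proof -
  let ?e = "\<lambda>y. if y = x then c else 0"
  have "(\<Sum>y\<in>X. translate y (?e y) - ?e y) = (\<Sum>y\<in>X. if y = x then translate x c - c else 0)"
    by (rule sum.cong) (auto simp: Modules.additive.zero[OF additive_translate])
  also have "\<dots> = translate x c - c"
    using assms finite_basis by simp
  finally show ?thesis
    unfolding coinvariant_relations_def
    by (intro CollectI exI[of _ ?e]) (use assms in \<open>auto simp: zero_in_bar_chains\<close>)
qed

text \<open>The product rule of Fox calculus: gh - 1 = (g - 1) h + (h - 1), together with the rule
  for inverses.\<close>

lemma coinvariant_relations_generate:
  assumes "g \<in> generate G X" "c \<in> bar_chains G (Suc n)"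
  shows "translate g c - c \<in> coinvariant_relations (Suc n)"
  using assms
proof (induction g arbitrary: c rule: generate.induct)
  case one
  then show ?case by (simp add: translate_one coinvariant_relations_zero)
next
  case (incl x)
  then show ?case by (simp add: coinvariant_relations_basis)
next
  case (inv x)
  have x: "x \<in> carrier G" using inv basis_closed by blast
  \<comment> \<open>From x^{-1} - 1 = (x - 1) (- x^{-1}).\<close>
  let ?c = "- translate (inv x) c"
  have "translate x ?c - ?c \<in> coinvariant_relations (Suc n)"
    by (intro coinvariant_relations_basis inv uminus_in_bar_chains translate_in_bar_chains inv_closed x)
  also have "translate x ?c - ?c = translate (inv x) c - c"
    using x inv by (simp add: Modules.additive.minus[OF additive_translate] translate_translate translate_one)
  finally show ?case .
next
  case (eng g h)
  have "g \<in> carrier G" "h \<in> carrier G"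
    using eng.hyps generate_in_carrier[OF basis_closed] by auto
  then have "translate (g \<otimes> h) c - c = (translate g (translate h c) - translate h c) + (translate h c - c)"
    using eng.prems by (simp add: translate_translate)
  moreover have "translate g (translate h c) - translate h c \<in> coinvariant_relations (Suc n)"
    by (intro eng.IH translate_in_bar_chains eng.prems \<open>h \<in> carrier G\<close>)
  moreover have "translate h c - c \<in> coinvariant_relations (Suc n)"
    by (intro eng.IH eng.prems)
  ultimately show ?case
    by (simp only: coinvariant_relations_add)
qed

text \<open>Both chains arise from a tuple by changing its head only, and the normalisation of the
  total degree forces the two new heads to have the same degree. They therefore differ by a left
  factor from the kernel.\<close>

lemma straighten_minus_lift_first_face:
  assumes "c \<in> bar_chains G (Suc n)"
  shows "straighten c - lift (first_face c) \<in> coinvariant_relations (Suc n)"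
  using assms
proof (induction rule: homogeneous_induct)
  case zero
  then show ?case
    by (simp add: Modules.additive.zero[OF additive_straighten] Modules.additive.zero[OF additive_lift]
        Modules.additive.zero[OF additive_first_face] coinvariant_relations_zero)
next
  case (add a b)
  then show ?case
    using coinvariant_relations_add[of "straighten a - lift (first_face a)" "Suc n" "straighten b - lift (first_face b)"]
    by (simp add: Modules.additive.add[OF additive_straighten] Modules.additive.add[OF additive_lift]
        Modules.additive.add[OF additive_first_face] algebra_simps)
next
  case (single gs q m)
  then obtain g hs where gs: "gs = g # hs" and hs: "length hs = n" by (auto simp: length_Suc_conv)
  define Q where "Q = q + word_degree gs"
  have Q: "q + word_degree hs = Q - \<phi> g" by (simp add: Q_def gs word_degree_def)
  define k where "k = \<sigma> (Q - \<phi> g)"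
  \<comment> \<open>The first face drops \<open>g\<close>, so the lift of the shorter tuple starts
    with \<open>k\<close> of degree \<phi> g - Q. The straightened tuple starts with
    \<open>\<sigma> Q \<otimes> g\<close>, of equal degree, and \<open>f\<close> is their
    quotient.\<close>
  define f where "f = \<sigma> Q \<otimes> g \<otimes> inv k"
  have g: "g \<in> carrier G" and k: "k \<in> carrier G" and s: "\<sigma> Q \<in> carrier G"
    using single gs by (auto simp: k_def section_closed)
  have fk: "f \<otimes> k = \<sigma> Q \<otimes> g" and f: "f \<in> carrier G"
    using g k s by (auto simp: f_def m_assoc)
  have "\<phi> f + \<phi> k = \<phi> (\<sigma> Q) + \<phi> g"
    using fk f g k s by (simp flip: degree_mult)
  then have "\<phi> f = 0" by (simp add: k_def degree_section)
  then have "f \<in> generate G X" using f by (simp add: kernel_generated)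
  moreover have "Poly_Mapping.single (k # hs) m \<in> bar_chains G (Suc n)"
    using single gs k by (auto intro!: single_in_bar_chains)
  ultimately have "translate f (Poly_Mapping.single (k # hs) m) - Poly_Mapping.single (k # hs) m
      \<in> coinvariant_relations (Suc n)"
    by (rule coinvariant_relations_generate)
  moreover have "straighten (Poly_Mapping.single gs m) = translate f (Poly_Mapping.single (k # hs) m)"
    using single by (simp add: straighten_single flip: Q_def) (simp add: gs translate_single fk)
  moreover have "lift (first_face (Poly_Mapping.single gs m)) = Poly_Mapping.single (k # hs) m"
    using single by (simp add: gs first_face_single lift_single Q prepend_single k_def)
  ultimately show ?case by simp
qed

lemma lookup_translate:
  assumes "c \<in> bar_chains G n" "g \<in> carrier G" "v \<in> carrier G"
  shows "Poly_Mapping.lookup (translate g c) (v # l) = Poly_Mapping.lookup c ((inv g \<otimes> v) # l)"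
  using assms(1)
proof (induction rule: homogeneous_induct)
  case (single gs q m)
  show ?case
  proof (cases gs)
    case Nil
    then show ?thesis by (simp add: translate_def lookup_single)
  next
    case (Cons h hs)
    then have "g \<otimes> h = v \<longleftrightarrow> h = inv g \<otimes> v"
      using single assms inv_solve_left[of h g v] by auto
    then show ?thesis by (simp add: Cons translate_single lookup_single when_def)
  qed
qed (simp_all add: Modules.additive.zero[OF additive_translate] Modules.additive.add[OF additive_translate] lookup_add)

text \<open>Translation changes the head of a tuple only. For each fixed tail \<open>l\<close> the
  coefficients thus form a separate relation in the group ring, to which
  \<open>basis_independent\<close> applies.\<close>

lemma coinvariant_relations_independent:
  assumes e: "\<And>x. x \<in> X \<Longrightarrow> e x \<in> bar_chains G (Suc n)"
    and eq: "(\<Sum>x\<in>X. translate x (e x) - e x) = 0" and "x \<in> X"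
  shows "e x = 0"
proof (rule poly_mapping_eqI)
  fix gs
  show "Poly_Mapping.lookup (e x) gs = Poly_Mapping.lookup 0 gs"
  proof (cases "length gs = Suc n \<and> set gs \<subseteq> carrier G")
    case False
    then show ?thesis using e[OF \<open>x \<in> X\<close>] by (auto simp: bar_chains_def in_keys_iff)
  next
    case True
    then obtain v l where gs: "gs = v # l" and v: "v \<in> carrier G" by (auto simp: length_Suc_conv)
    define d where "d y u = Poly_Mapping.lookup (e y) (u # l)" for y u
    have "d x v = 0"
    proof (rule basis_independent[of d])
      fix y assume "y \<in> X"
      have "{u. d y u \<noteq> 0} \<subseteq> hd ` Poly_Mapping.keys (e y)"
        by (auto simp: d_def in_keys_iff intro!: image_eqI[where x = "_ # l"])
      then show "finite {u. d y u \<noteq> 0}" by (rule finite_subset) simp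
    next
      fix u assume u: "u \<in> carrier G"
      have "(\<Sum>y\<in>X. d y (inv y \<otimes> u) - d y u) =
          (\<Sum>y\<in>X. Poly_Mapping.lookup (translate y (e y) - e y) (u # l))"
        by (rule sum.cong) (use e u basis_closed in \<open>auto simp: d_def lookup_minus lookup_translate[of _ "Suc n"]\<close>)
      also have "\<dots> = 0"
        using eq by (simp flip: lookup_sum)
      finally show "(\<Sum>y\<in>X. d y (inv y \<otimes> u) - d y u) = 0" .
    qed (use v \<open>x \<in> X\<close> in auto)
    then show ?thesis by (simp add: d_def gs)
  qed
qed

theorem bar_cycles_subset_bar_boundaries:
  assumes "2 \<le> n"
  shows "bar_cycles G act n \<subseteq> bar_boundaries G act n"
proof
  fix c assume "c \<in> bar_cycles G act n"
  moreover obtain k where n: "n = Suc (Suc k)"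
    using assms by (metis add_2_eq_Suc le_Suc_ex)
  ultimately have c: "c \<in> bar_chains G (Suc (Suc k))" and dc: "bar_boundary G act c = 0"
    by (auto simp: bar_cycles_def)
  have uc: "upper_boundary c = - first_face c"
    using dc by (simp add: bar_boundary_eq add_eq_0_iff)
  define w where "w = straighten c - lift (first_face c)"
  have c_eq: "c = bar_boundary G act (lift c) + w"
    using bar_boundary_lift[OF c] by (simp add: w_def uc Modules.additive.minus[OF additive_lift])
  have "bar_boundary G act w = bar_boundary G act c - bar_boundary G act (bar_boundary G act (lift c))"
    using arg_cong[OF c_eq, of "bar_boundary G act"] by (simp add: Modules.additive.add[OF additive_bar_boundary])
  then have "bar_boundary G act w = 0"
    using dc bar_boundary_bar_boundary_lift[OF c] by simp
  \<comment> \<open>Straightening keeps the first face of \<open>c\<close>, and lifting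
    \<open>first_face c\<close> has it as first face again. A cycle without first face is a cycle
    for the upper boundary alone.\<close>
  moreover have "first_face w = 0"
    unfolding w_def Modules.additive.diff[OF additive_first_face]
    using c by (simp add: first_face_straighten first_face_lift[OF first_face_in_bar_chains])
  ultimately have uw: "upper_boundary w = 0"
    by (simp add: bar_boundary_eq)
  obtain e where w: "w = (\<Sum>x\<in>X. translate x (e x) - e x)"
    and e: "\<And>x. x \<in> X \<Longrightarrow> e x \<in> bar_chains G (Suc (Suc k))"
    using straighten_minus_lift_first_face[OF c] by (auto simp: coinvariant_relations_def w_def)
  have "(\<Sum>x\<in>X. translate x (upper_boundary (e x)) - upper_boundary (e x)) = upper_boundary w"
    unfolding w Modules.additive.sum[OF additive_upper_boundary] Modules.additive.diff[OF additive_upper_boundary]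
    by (rule sum.cong) (use basis_closed in \<open>auto simp: upper_boundary_translate[OF e] subsetD\<close>)
  \<comment> \<open>Here the degree must be at least two: \<open>upper_boundary (e x)\<close> then
    consists of tuples of positive length, on which G acts freely through the head.\<close>
  then have ue: "upper_boundary (e x) = 0" if "x \<in> X" for x
    using coinvariant_relations_independent[of "\<lambda>x. upper_boundary (e x)" k x] that
      upper_boundary_in_bar_chains e uw by simp
  have "bar_boundary G act (prepend x (e x)) = - (translate x (e x) - e x)" if "x \<in> X" for x
    using bar_boundary_prepend[OF e[OF that], of x] ue[OF that] by (simp add: Modules.additive.zero[OF additive_prepend])
  then have "w = bar_boundary G act (- (\<Sum>x\<in>X. prepend x (e x)))"
    unfolding w Modules.additive.minus[OF additive_bar_boundary] Modules.additive.sum[OF additive_bar_boundary]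
    by (simp add: sum_subtractf)
  then have "c = bar_boundary G act (lift c + - (\<Sum>x\<in>X. prepend x (e x)))"
    unfolding Modules.additive.add[OF additive_bar_boundary] using c_eq by simp
  moreover have "lift c + - (\<Sum>x\<in>X. prepend x (e x)) \<in> bar_chains G (Suc n)"
    unfolding n
    by (intro add_in_bar_chains lift_in_bar_chains uminus_in_bar_chains sum_in_bar_chains prepend_in_bar_chains c e)
       (use basis_closed in auto)
  ultimately show "c \<in> bar_boundaries G act n"
    unfolding bar_boundaries_def by blast
qed

end


section \<open>Free groups\<close>

lemma reduced_word_Cons_iff:
  "reduced_word (a # w) \<longleftrightarrow> (w = [] \<or> hd w \<noteq> (fst a, \<not> snd a)) \<and> reduced_word w"
  by (cases w) (auto simp: reduced_word_def)

definition inverse_word :: "('f \<times> bool) list \<Rightarrow> ('f \<times> bool) list" where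
  "inverse_word w = rev (map (\<lambda>(x, b). (x, \<not> b)) w)"

lemma reduced_word_inverse_word: "reduced_word w \<Longrightarrow> reduced_word (inverse_word w)"
  unfolding reduced_word_def inverse_word_def successively_rev successively_map
  by (erule successively_mono) auto

lemma set_inverse_word: "fst ` set (inverse_word w) = fst ` set w"
  by (force simp: inverse_word_def image_iff)

lemma inverse_word_Cons: "inverse_word (a # w) = inverse_word w @ [(fst a, \<not> snd a)]"
  by (cases a) (simp add: inverse_word_def)

context group
begin

lemma word_value_Nil [simp]: "word_value G [] = \<one>"
  by (simp add: word_value_def)

lemma word_value_Cons: "word_value G ((x, b) # w) = (if b then x else inv x) \<otimes> word_value G w"
  by (simp add: word_value_def)

lemma word_value_closed [simp]: "fst ` set w \<subseteq> carrier G \<Longrightarrow> word_value G w \<in> carrier G"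
  by (induction w) (auto simp: word_value_Cons)

lemma word_value_append:
  "fst ` set u \<subseteq> carrier G \<Longrightarrow> fst ` set v \<subseteq> carrier G \<Longrightarrow>
     word_value G (u @ v) = word_value G u \<otimes> word_value G v"
  by (induction u) (auto simp: word_value_Cons m_assoc)

lemma word_value_inverse_word:
  "fst ` set w \<subseteq> carrier G \<Longrightarrow> word_value G (inverse_word w) = inv (word_value G w)"
proof (induction w)
  case (Cons a w)
  then show ?case
    using set_inverse_word[of w]
    by (cases a) (auto simp: inverse_word_Cons word_value_append word_value_Cons inv_mult_group)
qed (simp add: inverse_word_def)

text \<open>Letters are added from the left to an already reduced word; the new letter either
  cancels the head or keeps the word reduced.\<close>

lemma ex_reduced_word:
  assumes "X \<subseteq> carrier G" "fst ` set w \<subseteq> X"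
  shows "\<exists>v. fst ` set v \<subseteq> X \<and> reduced_word v \<and> word_value G v = word_value G w"
  using assms(2)
proof (induction w)
  case Nil
  then show ?case by (intro exI[of _ "[]"]) (auto simp: reduced_word_def)
next
  case (Cons a w)
  then obtain v where v: "fst ` set v \<subseteq> X" "reduced_word v" "word_value G v = word_value G w"
    by auto
  obtain x b where a: "a = (x, b)" by fastforce
  have x: "x \<in> carrier G" using Cons.prems a assms(1) by auto
  show ?case
  proof (cases "v \<noteq> [] \<and> hd v = (x, \<not> b)")
    case True
    then obtain u where u: "v = (x, \<not> b) # u" by (cases v) auto
    moreover have "word_value G u \<in> carrier G"
      using u v assms(1) by (intro word_value_closed) auto
    ultimately have "word_value G (a # w) = word_value G u"
      using x v(3)[symmetric] by (auto simp: a word_value_Cons simp flip: m_assoc)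
    then show ?thesis using u v by (auto simp: reduced_word_Cons_iff)
  next
    case False
    then show ?thesis
      using v Cons.prems a by (intro exI[of _ "a # v"]) (auto simp: reduced_word_Cons_iff word_value_Cons)
  qed
qed

lemma generate_word_value:
  assumes "X \<subseteq> carrier G" "g \<in> generate G X"
  shows "\<exists>w. fst ` set w \<subseteq> X \<and> word_value G w = g"
  using assms(2)
proof induction
  case one
  show ?case by (rule exI[of _ "[]"]) simp
next
  case (incl x)
  then show ?case using assms(1) by (intro exI[of _ "[(x, True)]"]) (auto simp: word_value_Cons)
next
  case (inv x)
  then show ?case using assms(1) by (intro exI[of _ "[(x, False)]"]) (auto simp: word_value_Cons)
next
  case (eng g h)
  then obtain u v where "fst ` set u \<subseteq> X" "word_value G u = g" "fst ` set v \<subseteq> X" "word_value G v = h"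
    by auto
  then show ?case
    using assms(1) by (intro exI[of _ "u @ v"]) (auto simp: word_value_append)
qed

end

locale free_group = group F for F (structure) +
  fixes X :: "'f set"
  assumes basis: "free_basis F X"
begin

lemma basis_carrier: "X \<subseteq> carrier F"
  using basis by (simp add: free_basis_def)

lemma word_carrier: "fst ` set w \<subseteq> X \<Longrightarrow> fst ` set w \<subseteq> carrier F"
  using basis_carrier by blast

lemma word_value_eq_one:
  "fst ` set w \<subseteq> X \<Longrightarrow> reduced_word w \<Longrightarrow> word_value F w = \<one> \<Longrightarrow> w = []"
  using basis unfolding free_basis_def by blast

lemma reduced_word_unique:
  assumes "fst ` set u \<subseteq> X" "fst ` set v \<subseteq> X" "reduced_word u" "reduced_word v"
    and "word_value F u = word_value F v"
  shows "u = v"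
  using assms
proof (induction u arbitrary: v)
  case Nil
  then show ?case using word_value_eq_one[of v] by simp
next
  case (Cons a u)
  show ?case
  proof (cases v)
    case Nil
    then show ?thesis using Cons.prems word_value_eq_one[of "a # u"] by simp
  next
    case v: (Cons b w)
    obtain x c where a: "a = (x, c)" by fastforce
    have u': "word_value F u \<in> carrier F" and w': "word_value F w \<in> carrier F"
      using Cons.prems v by (auto intro!: word_value_closed word_carrier)
    have x: "x \<in> carrier F" using Cons.prems(1) a basis_carrier by auto
    show ?thesis
    proof (cases "a = b")
      case True
      then have "word_value F ((x, c) # u) = word_value F ((x, c) # w)"
        using Cons.prems(5) v a by simp
      then have "word_value F u = word_value F w"
        using u' w' x by (simp add: word_value_Cons split: if_splits)
      then show ?thesis
        using Cons.IH[of w] Cons.prems v True by (simp add: reduced_word_Cons_iff)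
    next
      case False
      \<comment> \<open>The two words start with different letters, so nothing cancels where the
        inverse of the first meets the second. The concatenation is reduced and nonempty but has
        value \<one>, contrary to freeness.\<close>
      let ?w = "inverse_word (a # u) @ v"
      have "reduced_word (inverse_word (a # u))" by (rule reduced_word_inverse_word) fact
      then have "reduced_word ?w"
        using Cons.prems(4) False v
        by (cases a; cases b) (auto simp: reduced_word_def successively_append_iff inverse_word_Cons)
      moreover have X: "fst ` set ?w \<subseteq> X"
        using Cons.prems set_inverse_word[of "a # u"] by (auto simp: image_Un)
      moreover have "word_value F ?w = \<one>"
        using Cons.prems set_inverse_word[of "a # u"]
        by (simp add: word_value_append word_carrier word_value_inverse_word del: list.set)
      ultimately show ?thesis using word_value_eq_one[of ?w] v by simp
    qed
  qed
qed

definition normal_form :: "'f \<Rightarrow> ('f \<times> bool) list" where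
  "normal_form g = (THE w. fst ` set w \<subseteq> X \<and> reduced_word w \<and> word_value F w = g)"

lemma normal_form_eqI:
  assumes "fst ` set w \<subseteq> X" "reduced_word w" "word_value F w = g"
  shows "normal_form g = w"
  unfolding normal_form_def
proof (rule the_equality)
  fix v assume v: "fst ` set v \<subseteq> X \<and> reduced_word v \<and> word_value F v = g"
  show "v = w" by (rule reduced_word_unique) (use v assms in simp_all)
qed (use assms in simp)

lemma normal_form:
  assumes "g \<in> carrier F"
  shows "fst ` set (normal_form g) \<subseteq> X" "reduced_word (normal_form g)" "word_value F (normal_form g) = g"
proof -
  have "g \<in> generate F X" using assms basis by (simp add: free_basis_def)
  then obtain v where v: "fst ` set v \<subseteq> X" "word_value F v = g"
    using generate_word_value[OF basis_carrier, of g] by blast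
  obtain w where w: "fst ` set w \<subseteq> X" "reduced_word w" "word_value F w = g"
    using ex_reduced_word[OF basis_carrier v(1)] v(2) by blast
  have "normal_form g = w" using w by (rule normal_form_eqI)
  then show "fst ` set (normal_form g) \<subseteq> X" "reduced_word (normal_form g)" "word_value F (normal_form g) = g"
    using w by simp_all
qed

lemma normal_form_letter_mult:
  assumes "g \<in> carrier F" "x \<in> X" "normal_form g = [] \<or> hd (normal_form g) \<noteq> (x, \<not> b)"
  shows "normal_form ((if b then x else inv x) \<otimes> g) = (x, b) # normal_form g"
  using normal_form[OF assms(1)] assms(2,3)
  by (intro normal_form_eqI) (auto simp: reduced_word_Cons_iff word_value_Cons)

lemma normal_form_letter_cancel:
  assumes "g \<in> carrier F" "x \<in> X" "normal_form g = (x, \<not> b) # w"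
  shows "normal_form ((if b then x else inv x) \<otimes> g) = w"
proof -
  have x: "x \<in> carrier F" using assms basis_carrier by auto
  have w: "fst ` set w \<subseteq> X" "reduced_word w" "word_value F ((x, \<not> b) # w) = g"
    using normal_form[OF assms(1)] assms(3) by (auto simp: reduced_word_Cons_iff)
  have "word_value F w \<in> carrier F"
    using w by (intro word_value_closed word_carrier)
  then show ?thesis
    using w x by (intro normal_form_eqI) (auto simp: word_value_Cons simp flip: m_assoc)
qed

text \<open>\<open>d x v\<close> is the coefficient of the edge from \<open>v\<close> to \<open>x v\<close> in a finite chain on the Cayley graph, and
  the hypothesis says that the chain has no boundary. The Cayley graph is a tree, so an edge of the
  support that reaches farthest from \<open>\<one>\<close> ends in a leaf of the support.\<close>

lemma basis_independent:
  fixes d :: "'f \<Rightarrow> 'f \<Rightarrow> 'm::ab_group_add"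
  assumes "finite X" and fin: "\<And>x. x \<in> X \<Longrightarrow> finite {v. d x v \<noteq> 0}"
    and eq: "\<And>v. v \<in> carrier F \<Longrightarrow> (\<Sum>x\<in>X. d x (inv x \<otimes> v) - d x v) = 0"
    and "x \<in> X" "v \<in> carrier F"
  shows "d x v = 0"
proof (rule ccontr)
  assume nonzero: "d x v \<noteq> 0"
  define len where "len g = length (normal_form g)" for g
  define height where "height = (\<lambda>(x, v). max (len v) (len (x \<otimes> v)))"
  define S where "S = {(x, v). x \<in> X \<and> v \<in> carrier F \<and> d x v \<noteq> 0}"
  have "S \<subseteq> Sigma X (\<lambda>x. {v. d x v \<noteq> 0})" by (auto simp: S_def)
  then have finS: "finite S" using \<open>finite X\<close> fin by (auto intro: finite_subset)
  have "S \<noteq> {}" using nonzero assms by (auto simp: S_def)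
  then have "Max (height ` S) \<in> height ` S" using finS by (intro Max_in) auto
  then obtain y u where yu: "(y, u) \<in> S" and "height (y, u) = Max (height ` S)" by auto
  then have max: "height (z, w) \<le> height (y, u)" if "(z, w) \<in> S" for z w
    using that finS by simp
  have y: "y \<in> X" and u: "u \<in> carrier F" and duy: "d y u \<noteq> 0" using yu by (auto simp: S_def)
  have Xc: "z \<in> carrier F" if "z \<in> X" for z using that basis_carrier by auto
  have vanish: "d z w = 0" if "z \<in> X" "w \<in> carrier F" "height (y, u) < height (z, w)" for z w
    using max[of z w] that by (auto simp: S_def)
  have len_mult: "len (z \<otimes> w) = Suc (len w)"
    if "z \<in> X" "w \<in> carrier F" "normal_form w = [] \<or> hd (normal_form w) \<noteq> (z, False)" for z w
    using normal_form_letter_mult[of w z True] that by (simp add: len_def)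
  have len_inv_mult: "len (inv z \<otimes> w) = Suc (len w)"
    if "z \<in> X" "w \<in> carrier F" "normal_form w = [] \<or> hd (normal_form w) \<noteq> (z, True)" for z w
    using normal_form_letter_mult[of w z False] that by (simp add: len_def)
  show False
  \<comment> \<open>The case distinction decides which end of the edge from \<open>u\<close> to y u
    is farther from \<one>. Here it is y u: any other edge at this vertex leads to a longer normal
    form and exceeds the maximal height, so only \<open>d y u\<close> survives in the equation
    there.\<close>
  proof (cases "normal_form u = [] \<or> hd (normal_form u) \<noteq> (y, False)")
    case True
    define w where "w = y \<otimes> u"
    have w: "w \<in> carrier F" using y u Xc by (simp add: w_def)
    have nf: "normal_form w = (y, True) # normal_form u"
      using normal_form_letter_mult[of u y True] True y u by (simp add: w_def)
    then have h: "height (y, u) = len w" by (simp add: height_def len_def w_def)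
    have 1: "d z w = 0" if "z \<in> X" for z
      using that w nf len_mult[of z w] by (intro vanish) (auto simp: h, simp add: height_def)
    have 2: "d z (inv z \<otimes> w) = 0" if "z \<in> X" "z \<noteq> y" for z
      using that w nf len_inv_mult[of z w] Xc by (intro vanish) (auto simp: h, simp add: height_def)
    have "(\<Sum>z\<in>X. d z (inv z \<otimes> w) - d z w) = (\<Sum>z\<in>X. if z = y then d y u else 0)"
      using 1 2 u y Xc by (intro sum.cong) (auto simp: w_def simp flip: m_assoc)
    then show False using eq[OF w] y \<open>finite X\<close> duy by simp
  next
    case False
    \<comment> \<open>Now \<open>u\<close> starts with the inverse of \<open>y\<close> and is the
      farther end, so the equation is used at \<open>u\<close>, where the edge is outgoing and
      appears with a minus sign.\<close>
    then obtain t where nf: "normal_form u = (y, False) # t" by (cases "normal_form u") auto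
    then have "normal_form (y \<otimes> u) = t"
      using normal_form_letter_cancel[of u y True] y u by simp
    then have h: "height (y, u) = len u" using nf by (simp add: height_def len_def)
    have 1: "d z u = 0" if "z \<in> X" "z \<noteq> y" for z
      using that u nf len_mult[of z u] by (intro vanish) (auto simp: h, simp add: height_def)
    have 2: "d z (inv z \<otimes> u) = 0" if "z \<in> X" for z
      using that u nf len_inv_mult[of z u] Xc by (intro vanish) (auto simp: h, simp add: height_def)
    have "(\<Sum>z\<in>X. d z (inv z \<otimes> u) - d z u) = (\<Sum>z\<in>X. if z = y then - d y u else 0)"
      using 1 2 by (intro sum.cong) auto
    then show False using eq[OF u] y \<open>finite X\<close> duy by simp
  qed
qed

end


section \<open>Uniqueness of the order of a module\<close>

lemma det_expand_row:
  fixes d :: "'l::comm_ring_1"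
  assumes "i < s" and A: "A \<in> carrier_mat s s" and B: "\<And>k. k \<in> K \<Longrightarrow> B k \<in> carrier_mat s s"
    and row: "\<And>j. j < s \<Longrightarrow> A $$ (i, j) = (\<Sum>k\<in>K. c k * B k $$ (i, j))"
    and other: "\<And>k l j. k \<in> K \<Longrightarrow> l < s \<Longrightarrow> l \<noteq> i \<Longrightarrow> j < s \<Longrightarrow> B k $$ (l, j) = A $$ (l, j)"
  shows "Determinant.det A = (\<Sum>k\<in>K. c k * Determinant.det (B k))"
proof -
  have del: "mat_delete (B k) i j = mat_delete A i j" if "k \<in> K" "j < s" for k j
    using B[OF that(1)] A other[OF that(1)] that(2) \<open>i < s\<close>
    by (intro eq_matI) (auto simp: mat_delete_def)
  have "Determinant.det A = (\<Sum>j<s. A $$ (i, j) * cofactor A i j)"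
    by (rule laplace_expansion_row[OF A \<open>i < s\<close>])
  also have "\<dots> = (\<Sum>j<s. \<Sum>k\<in>K. c k * (B k $$ (i, j) * cofactor (B k) i j))"
    using row del by (intro sum.cong) (auto simp: cofactor_def sum_distrib_right sum_distrib_left mult_ac intro!: sum.cong)
  also have "\<dots> = (\<Sum>k\<in>K. c k * (\<Sum>j<s. B k $$ (i, j) * cofactor (B k) i j))"
    by (subst sum.swap) (simp add: sum_distrib_left)
  also have "\<dots> = (\<Sum>k\<in>K. c k * Determinant.det (B k))"
    using laplace_expansion_row[OF B \<open>i < s\<close>] by (intro sum.cong) auto
  finally show ?thesis .
qed

lemma row_span_combination:
  assumes "v \<in> row_span s A"
  shows "\<exists>rs c. set rs \<subseteq> A \<and>
    (\<forall>j<s. vec_index v j = (\<Sum>k<length rs. c k * vec_index (rs ! k) j))"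
proof -
  obtain rs c where rs: "set rs \<subseteq> A" and c: "c \<in> carrier_vec (length rs)"
    and v: "v = transpose_mat (mat_of_rows s rs) *\<^sub>v c"
    using assms by (auto simp: row_span_def)
  have "vec_index v j = (\<Sum>k<length rs. vec_index c k * vec_index (rs ! k) j)" if "j < s" for j
    using that c by (auto simp: v scalar_prod_def mat_of_rows_def mult.commute atLeast0LessThan intro!: sum.cong)
  then show ?thesis using rs by blast
qed

lemma row_span_carrier: "row_span s A \<subseteq> carrier_vec s"
  by (auto simp: row_span_def intro!: carrier_vecI)

lemma zero_in_row_span: "0\<^sub>v s \<in> row_span s A"
proof -
  have "transpose_mat (mat_of_rows s []) *\<^sub>v vNil = (0\<^sub>v s :: 'a Matrix.vec)"
    by (intro eq_vecI) (auto simp: scalar_prod_def)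
  then show ?thesis
    unfolding row_span_def by (intro CollectI exI[of _ "[]"] exI[of _ vNil]) auto
qed

lemma dvd_det_rows_in_row_span:
  fixes d :: "'l::comm_ring_1"
  assumes A: "A \<subseteq> carrier_vec s" and d: "\<And>x. x \<in> maximal_minors s A \<Longrightarrow> d dvd x"
    and rs: "length rs = s" "set rs \<subseteq> row_span s A"
  shows "d dvd Determinant.det (mat_of_rows s rs)"
proof -
  \<comment> \<open>Multilinearity, one row at a time: the first \<open>k\<close> rows may be
    arbitrary in the span, the others already lie in \<open>A\<close>. The induction step expands
    row \<open>k\<close> into rows of \<open>A\<close>.\<close>
  have "d dvd Determinant.det (mat_of_rows s rs)"
    if "length rs = s" "\<And>i. i < k \<Longrightarrow> rs ! i \<in> row_span s A" "\<And>i. k \<le> i \<Longrightarrow> i < s \<Longrightarrow> rs ! i \<in> A" "k \<le> s" for rs k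
    using that
  proof (induction k arbitrary: rs)
    case 0
    then have "set rs \<subseteq> A" by (auto simp: in_set_conv_nth)
    then show ?case using d 0 by (auto simp: maximal_minors_def)
  next
    case (Suc k)
    have "rs ! k \<in> row_span s A" using Suc.prems by simp
    then obtain qs c where qs: "set qs \<subseteq> A"
      and qc: "\<And>j. j < s \<Longrightarrow> vec_index (rs ! k) j = (\<Sum>i<length qs. c i * vec_index (qs ! i) j)"
      by (blast dest: row_span_combination)
    have "Determinant.det (mat_of_rows s rs) =
        (\<Sum>i<length qs. c i * Determinant.det (mat_of_rows s (rs[k := qs ! i])))"
      using Suc.prems qc by (intro det_expand_row[of k s]) (auto simp: mat_of_rows_def)
    moreover have "d dvd Determinant.det (mat_of_rows s (rs[k := qs ! i]))" if "i < length qs" for i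
    proof (rule Suc.IH)
      show "rs[k := qs ! i] ! l \<in> A" if "k \<le> l" "l < s" for l
        using that Suc.prems qs \<open>i < length qs\<close> by (cases "l = k") auto
    qed (use Suc.prems in auto)
    ultimately show ?case by (auto intro!: dvd_sum dvd_mult)
  qed
  moreover have "rs ! i \<in> row_span s A" if "i < s" for i
    using rs that nth_mem by blast
  ultimately show ?thesis
    using rs(1) by (metis leD order_refl)
qed

text \<open>Laplace expansion along the first \<open>r\<close> columns writes the determinant as a combination of minors of
  the last \<open>s\<close> columns.\<close>

lemma dvd_det_last_columns:
  fixes d :: "'l::comm_ring_1"
  assumes d: "\<And>rs. length rs = s \<Longrightarrow> set rs \<subseteq> V \<Longrightarrow> d dvd Determinant.det (mat_of_rows s rs)"
    and "M \<in> carrier_mat (r + s) (r + s)"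
    and "\<And>i. i < r + s \<Longrightarrow> Matrix.vec s (\<lambda>j. M $$ (i, r + j)) \<in> V"
  shows "d dvd Determinant.det M"
  using assms(2,3)
proof (induction r arbitrary: M)
  case 0
  let ?rs = "map (\<lambda>i. Matrix.vec s (\<lambda>j. M $$ (i, j))) [0..<s]"
  have "M = mat_of_rows s ?rs"
    using 0 by (intro eq_matI) (auto simp: mat_of_rows_def)
  moreover have "d dvd Determinant.det (mat_of_rows s ?rs)"
    using 0 by (intro d) auto
  ultimately show ?case by simp
next
  case (Suc r)
  have M: "M \<in> carrier_mat (Suc (r + s)) (Suc (r + s))" using Suc.prems by simp
  have "d dvd Determinant.det (mat_delete M i 0)" if i: "i < Suc (r + s)" for i
  proof (rule Suc.IH)
    show "mat_delete M i 0 \<in> carrier_mat (r + s) (r + s)"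
      using mat_delete_carrier[OF M] by simp
    fix l assume l: "l < r + s"
    let ?l = "if l < i then l else Suc l"
    have "Matrix.vec s (\<lambda>j. mat_delete M i 0 $$ (l, r + j)) = Matrix.vec s (\<lambda>j. M $$ (?l, Suc r + j))"
      using M l by (intro eq_vecI) (auto simp: mat_delete_def)
    then show "Matrix.vec s (\<lambda>j. mat_delete M i 0 $$ (l, r + j)) \<in> V"
      using Suc.prems(2)[of ?l] l by simp
  qed
  then have "d dvd (\<Sum>i<Suc (r + s). M $$ (i, 0) * cofactor M i 0)"
    by (intro dvd_sum) (auto simp: cofactor_def)
  then show ?case
    using laplace_expansion_column[OF M, of 0] by simp
qed


lemma subset_row_span:
  assumes "A \<subseteq> carrier_vec s"
  shows "A \<subseteq> row_span s A"
proof
  fix r assume "r \<in> A"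
  moreover have "transpose_mat (mat_of_rows s [r]) *\<^sub>v Matrix.vec 1 (\<lambda>_. 1) = r"
    using assms \<open>r \<in> A\<close> by (intro eq_vecI) (auto simp: scalar_prod_def mat_of_rows_def)
  ultimately show "r \<in> row_span s A"
    unfolding row_span_def
    by (intro CollectI exI[of _ "[r]"] exI[of _ "Matrix.vec 1 (\<lambda>_. 1)"]) auto
qed

text \<open>\<open>M\<close> is a bare record without assumed module laws, so the value at the zero
  vector cannot be derived from additivity and is a premise. The induction fills in the coordinates
  of \<open>u\<close> one after another.\<close>

lemma linear_eq_on_unit_vecs:
  fixes M :: "('l::comm_ring_1, 'x) module"
  assumes f_add: "\<And>u v. u \<in> carrier_vec s \<Longrightarrow> v \<in> carrier_vec s \<Longrightarrow> f (u + v) = f u \<oplus>\<^bsub>M\<^esub> f v"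
    and f_smult: "\<And>a u. u \<in> carrier_vec s \<Longrightarrow> f (a \<cdot>\<^sub>v u) = a \<odot>\<^bsub>M\<^esub> f u"
    and g_add: "\<And>u v. u \<in> carrier_vec s \<Longrightarrow> v \<in> carrier_vec s \<Longrightarrow> g (u + v) = g u \<oplus>\<^bsub>M\<^esub> g v"
    and g_smult: "\<And>a u. u \<in> carrier_vec s \<Longrightarrow> g (a \<cdot>\<^sub>v u) = a \<odot>\<^bsub>M\<^esub> g u"
    and zero: "f (0\<^sub>v s) = g (0\<^sub>v s)"
    and unit: "\<And>i. i < s \<Longrightarrow> f (unit_vec s i) = g (unit_vec s i)"
    and u: "u \<in> carrier_vec s"
  shows "f u = g u"
proof -
  let ?u = "\<lambda>k. Matrix.vec s (\<lambda>i. if i < k then vec_index u i else 0)"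
  have "f (?u k) = g (?u k)" if "k \<le> s" for k
    using that
  proof (induction k)
    case 0
    have "?u 0 = 0\<^sub>v s" by (intro eq_vecI) auto
    then show ?case using zero by simp
  next
    case (Suc k)
    have "?u (Suc k) = ?u k + vec_index u k \<cdot>\<^sub>v unit_vec s k"
      using Suc.prems by (intro eq_vecI) (auto simp: less_Suc_eq)
    then show ?case
      using Suc by (simp add: f_add g_add f_smult g_smult unit)
  qed
  moreover have "?u s = u" using u by (intro eq_vecI) auto
  ultimately show ?thesis by (metis order_refl)
qed

text \<open>A minor of the second presentation is realised as the determinant of a larger matrix
  whose last \<open>s\<close> columns have all their rows among the relations of the first.
  Expanding along the other columns leaves minors of those relations, all divisible by
  \<open>d\<close>.\<close>

lemma dvd_maximal_minors_presentation:
  fixes M :: "('l::idom, 'x) module"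
  assumes "is_presentation_matrix M s A" "is_presentation_matrix M s' A'"
    and d: "\<And>x. x \<in> maximal_minors s A \<Longrightarrow> d dvd x"
    and "y \<in> maximal_minors s' A'"
  shows "d dvd y"
proof -
  obtain rs' where y: "y = Determinant.det (mat_of_rows s' rs')" and rs': "length rs' = s'" "set rs' \<subseteq> A'"
    using assms(4) by (auto simp: maximal_minors_def)
  obtain e where A: "A \<subseteq> carrier_vec s" and e_img: "e ` carrier_vec s = carrier M"
    and e_add: "\<And>u v. u \<in> carrier_vec s \<Longrightarrow> v \<in> carrier_vec s \<Longrightarrow> e (u + v) = e u \<oplus>\<^bsub>M\<^esub> e v"
    and e_smult: "\<And>a u. u \<in> carrier_vec s \<Longrightarrow> e (a \<cdot>\<^sub>v u) = a \<odot>\<^bsub>M\<^esub> e u"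
    and e_ker: "{u \<in> carrier_vec s. e u = \<zero>\<^bsub>M\<^esub>} = row_span s A"
    using assms(1) unfolding is_presentation_matrix_def by blast
  obtain e' where A': "A' \<subseteq> carrier_vec s'" and e'_img: "e' ` carrier_vec s' = carrier M"
    and e'_add: "\<And>u v. u \<in> carrier_vec s' \<Longrightarrow> v \<in> carrier_vec s' \<Longrightarrow> e' (u + v) = e' u \<oplus>\<^bsub>M\<^esub> e' v"
    and e'_smult: "\<And>a u. u \<in> carrier_vec s' \<Longrightarrow> e' (a \<cdot>\<^sub>v u) = a \<odot>\<^bsub>M\<^esub> e' u"
    and e'_ker: "{u \<in> carrier_vec s'. e' u = \<zero>\<^bsub>M\<^esub>} = row_span s' A'"
    using assms(2) unfolding is_presentation_matrix_def by blast
  have e_zero: "e (0\<^sub>v s) = \<zero>\<^bsub>M\<^esub>" and e'_zero: "e' (0\<^sub>v s') = \<zero>\<^bsub>M\<^esub>"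
    using e_ker e'_ker zero_in_row_span[of s A] zero_in_row_span[of s' A'] by blast+
  have "\<exists>p. p \<in> carrier_vec s \<and> e p = e' (unit_vec s' j)" for j
    using e_img e'_img by (metis (no_types, lifting) image_iff imageI unit_vec_carrier)
  then obtain p where p: "\<And>j. p j \<in> carrier_vec s" "\<And>j. e (p j) = e' (unit_vec s' j)"
    by metis
  have "\<exists>q. q \<in> carrier_vec s' \<and> e' q = e (unit_vec s i)" for i
    using e_img e'_img by (metis (no_types, lifting) image_iff imageI unit_vec_carrier)
  then obtain q where q: "\<And>i. q i \<in> carrier_vec s'" "\<And>i. e' (q i) = e (unit_vec s i)"
    by metis
  \<comment> \<open>The rows of \<open>P\<close> write the second generators through the first,
    those of \<open>Q\<close> the first through the second.\<close>
  define P where "P = Matrix.mat s' s (\<lambda>(j, i). vec_index (p j) i)"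
  define Q where "Q = Matrix.mat s s' (\<lambda>(i, j). vec_index (q i) j)"
  define T where "T u = transpose_mat P *\<^sub>v u" for u
  have P: "P \<in> carrier_mat s' s" and Q: "Q \<in> carrier_mat s s'" by (auto simp: P_def Q_def)
  have TP: "transpose_mat P \<in> carrier_mat s s'" using P by simp
  have T: "T u \<in> carrier_vec s" if "u \<in> carrier_vec s'" for u
    unfolding T_def using TP that by (rule mult_mat_vec_carrier)
  have T_unit: "T (unit_vec s' j) = p j" if "j < s'" for j
    using that p(1)[of j] TP by (intro eq_vecI) (auto simp: T_def P_def)
  have eT: "e' u = e (T u)" if "u \<in> carrier_vec s'" for u
  proof (rule linear_eq_on_unit_vecs[of s' e' M "\<lambda>u. e (T u)"])
    show "e (T (u + v)) = e (T u) \<oplus>\<^bsub>M\<^esub> e (T v)" if "u \<in> carrier_vec s'" "v \<in> carrier_vec s'" for u v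
      using that T e_add by (simp add: T_def mult_add_distrib_mat_vec[OF TP])
    show "e (T (a \<cdot>\<^sub>v u)) = a \<odot>\<^bsub>M\<^esub> e (T u)" if "u \<in> carrier_vec s'" for a u
    proof -
      have "T (a \<cdot>\<^sub>v u) = a \<cdot>\<^sub>v T u"
        using that TP by (intro eq_vecI) (auto simp: T_def)
      then show ?thesis using that T e_smult by simp
    qed
    have "T (0\<^sub>v s') = 0\<^sub>v s" using TP by (intro eq_vecI) (auto simp: T_def)
    then show "e' (0\<^sub>v s') = e (T (0\<^sub>v s'))" by (simp add: e_zero e'_zero)
  qed (use that T_unit p e'_add e'_smult in auto)
  define B where "B = mat_of_rows s' rs'"
  have B: "B \<in> carrier_mat s' s'" using rs' by (intro carrier_matI) (simp_all add: B_def mat_of_rows_def)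
  \<comment> \<open>\<open>N\<close> is the block matrix with rows \<open>B\<close>, 0 and - Q, 1
    after adding the first block column times \<open>P\<close> to the second, so it has the
    determinant of \<open>B\<close>. In the second block column \<open>B * P\<close> rewrites
    relations in the first generators, and \<open>1 - Q * P\<close> records that translating a
    generator back and forth does not change its image in \<open>M\<close>.\<close>
  define N where "N = four_block_mat B (B * P) (- Q) (1\<^sub>m s - Q * P)"
  let ?L = "four_block_mat B (0\<^sub>m s' s) (- Q) (1\<^sub>m s)" and ?U = "four_block_mat (1\<^sub>m s') P (0\<^sub>m s s') (1\<^sub>m s)"
  have mQ: "- Q \<in> carrier_mat s s'" using Q by simp
  have "?L * ?U = four_block_mat (B * 1\<^sub>m s' + 0\<^sub>m s' s * 0\<^sub>m s s') (B * P + 0\<^sub>m s' s * 1\<^sub>m s)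
      ((- Q) * 1\<^sub>m s' + 1\<^sub>m s * 0\<^sub>m s s') ((- Q) * P + 1\<^sub>m s * 1\<^sub>m s)"
    by (rule mult_four_block_mat[OF B _ mQ _ _ P]) auto
  also have "\<dots> = N"
  proof -
    have "(- Q) * P + 1\<^sub>m s * 1\<^sub>m s = 1\<^sub>m s - Q * P"
      using P Q by (intro eq_matI) auto
    then show ?thesis using B P Q by (simp add: N_def)
  qed
  finally have "Determinant.det N = Determinant.det (?L * ?U)" by simp
  also have "\<dots> = Determinant.det ?L * Determinant.det ?U"
    using B P Q by (intro det_mult[of _ "s' + s"] four_block_carrier_mat) auto
  also have "Determinant.det ?L = Determinant.det B"
    using det_four_block_mat_upper_right_zero[OF B refl mQ, of "1\<^sub>m s"] by simp
  also have "Determinant.det ?U = 1"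
    using det_four_block_mat_lower_left_zero[OF one_carrier_mat P refl one_carrier_mat] by simp
  finally have "Determinant.det N = Determinant.det B" by simp
  moreover have "d dvd Determinant.det N"
  proof (rule dvd_det_last_columns[where s = s and V = "row_span s A" and r = s'])
    show "d dvd Determinant.det (mat_of_rows s rs)" if "length rs = s" "set rs \<subseteq> row_span s A" for rs
      using that by (intro dvd_det_rows_in_row_span[OF A d])
    show "N \<in> carrier_mat (s' + s) (s' + s)"
      unfolding N_def using B P Q by (intro four_block_carrier_mat) auto
    fix i assume i: "i < s' + s"
    let ?v = "Matrix.vec s (\<lambda>j. N $$ (i, s' + j))"
    have "e ?v = \<zero>\<^bsub>M\<^esub>"
    proof (cases "i < s'")
      case True
      then have r: "rs' ! i \<in> A'" using rs' by auto
      then have rc: "rs' ! i \<in> carrier_vec s'" using A' by blast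
      have "Matrix.row B i = rs' ! i" using True rs' rc by (simp add: B_def)
      then have "?v = T (rs' ! i)"
        using True B P Q rc by (intro eq_vecI) (auto simp: N_def T_def comm_scalar_prod[where n = s'])
      moreover have "e' (rs' ! i) = \<zero>\<^bsub>M\<^esub>"
        using r subset_row_span[OF A'] e'_ker by blast
      ultimately show ?thesis using eT[OF rc] by simp
    next
      case False
      define k where "k = i - s'"
      have k: "k < s" "i = s' + k" using i False by (auto simp: k_def)
      have "Matrix.row Q k = q k" using k q(1)[of k] by (intro eq_vecI) (auto simp: Q_def)
      then have "?v = unit_vec s k + (- 1) \<cdot>\<^sub>v T (q k)"
        using k B P Q q(1)[of k] TP
        by (intro eq_vecI) (auto simp: N_def T_def unit_vec_def comm_scalar_prod[where n = s'])
      then have "e ?v = e (unit_vec s k) \<oplus>\<^bsub>M\<^esub> (- 1) \<odot>\<^bsub>M\<^esub> e (T (q k))"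
        using T[OF q(1)] by (simp add: e_add e_smult)
      also have "e (unit_vec s k) = e (T (q k))"
        using eT[OF q(1)] q(2) by simp
      \<comment> \<open>In the absence of laws for \<open>M\<close>, the cancellation is carried out
        among vectors, and \<open>e\<close> is applied afterwards.\<close>
      also have "e (T (q k)) \<oplus>\<^bsub>M\<^esub> (- 1) \<odot>\<^bsub>M\<^esub> e (T (q k)) = e (T (q k) + (- 1) \<cdot>\<^sub>v T (q k))"
        using T[OF q(1)] by (simp add: e_add e_smult)
      also have "T (q k) + (- 1) \<cdot>\<^sub>v T (q k) = 0\<^sub>v s"
        using T[OF q(1)[of k]] by (intro eq_vecI) auto
      finally show ?thesis by (simp add: e_zero)
    qed
    then show "?v \<in> row_span s A" unfolding e_ker[symmetric] by simp
  qed
  ultimately show ?thesis by (simp add: y B_def)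
qed

lemma is_order_of_module_dvd:
  fixes M :: "('l::idom, 'x) module"
  assumes "is_order_of_module M d" "is_order_of_module M d'"
  shows "d dvd d'"
proof -
  obtain s A s' A' where "is_presentation_matrix M s A" "is_greatest_common_divisor (maximal_minors s A) d"
    "is_presentation_matrix M s' A'" "is_greatest_common_divisor (maximal_minors s' A') d'"
    using assms by (auto simp: is_order_of_module_def)
  then show ?thesis
    using dvd_maximal_minors_presentation[of M s A s' A' d] by (auto simp: is_greatest_common_divisor_def)
qed

text \<open>The presentation without generators, whose only maximal minor is the empty determinant
  1.\<close>

lemma is_order_of_zero_module:
  fixes M :: "('l::comm_ring_1, 'x) module"
  assumes "carrier M = {\<zero>\<^bsub>M\<^esub>}" "\<zero>\<^bsub>M\<^esub> \<oplus>\<^bsub>M\<^esub> \<zero>\<^bsub>M\<^esub> = \<zero>\<^bsub>M\<^esub>" "\<And>a. a \<odot>\<^bsub>M\<^esub> \<zero>\<^bsub>M\<^esub> = \<zero>\<^bsub>M\<^esub>"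
  shows "is_order_of_module M 1"
proof -
  have carrier: "carrier_vec 0 = {0\<^sub>v 0 :: 'l Matrix.vec}"
    by auto
  have "row_span 0 {} = {0\<^sub>v 0 :: 'l Matrix.vec}"
    using row_span_carrier[of 0 "{}"] zero_in_row_span[of 0 "{}"] carrier by blast
  then have "is_presentation_matrix M 0 {}"
    unfolding is_presentation_matrix_def using assms by (intro conjI exI[of _ "\<lambda>_. \<zero>\<^bsub>M\<^esub>"]) (simp_all add: carrier)
  moreover have "Determinant.det (mat_of_rows 0 [] :: 'l mat) = 1"
    by (rule det_dim_zero) (simp add: mat_of_rows_def)
  then have "is_greatest_common_divisor (maximal_minors 0 {}) (1 :: 'l)"
    by (auto simp: is_greatest_common_divisor_def maximal_minors_def)
  ultimately show ?thesis unfolding is_order_of_module_def by blast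
qed


section \<open>Laurent polynomials up to monomials\<close>

text \<open>If p + q is a sum of exponents in one way only, a single product of coefficients reaches
  it. Splitting off the terms at \<open>p\<close> and \<open>q\<close> isolates that
  product.\<close>

lemma lookup_mult_unique:
  fixes f g :: "'b::comm_monoid_add \<Rightarrow>\<^sub>0 'a::comm_ring_1"
  assumes "\<And>i j. i \<in> Poly_Mapping.keys f \<Longrightarrow> j \<in> Poly_Mapping.keys g \<Longrightarrow> i + j = p + q \<Longrightarrow> i = p \<and> j = q"
  shows "Poly_Mapping.lookup (f * g) (p + q) = Poly_Mapping.lookup f p * Poly_Mapping.lookup g q"
proof -
  define f' where "f' = f - Poly_Mapping.single p (Poly_Mapping.lookup f p)"
  define g' where "g' = g - Poly_Mapping.single q (Poly_Mapping.lookup g q)"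
  have keys: "i \<in> Poly_Mapping.keys f \<and> i \<noteq> p" if "i \<in> Poly_Mapping.keys f'" for i
    using that by (auto simp: f'_def in_keys_iff lookup_minus lookup_single when_def split: if_splits)
  have keys': "j \<in> Poly_Mapping.keys g \<and> j \<noteq> q" if "j \<in> Poly_Mapping.keys g'" for j
    using that by (auto simp: g'_def in_keys_iff lookup_minus lookup_single when_def split: if_splits)
  have "p + q \<notin> Poly_Mapping.keys (f' * g)"
    using Poly_Mapping.keys_mult[of f' g] keys assms by fastforce
  moreover have "p + q \<notin> Poly_Mapping.keys (Poly_Mapping.single p (Poly_Mapping.lookup f p) * g')"
  proof
    assume "p + q \<in> Poly_Mapping.keys (Poly_Mapping.single p (Poly_Mapping.lookup f p) * g')"
    then obtain i j where "p + q = i + j" "i \<in> Poly_Mapping.keys (Poly_Mapping.single p (Poly_Mapping.lookup f p))"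
      "j \<in> Poly_Mapping.keys g'"
      using Poly_Mapping.keys_mult[of "Poly_Mapping.single p (Poly_Mapping.lookup f p)" g'] by blast
    then show False
      using keys'[of j] assms[of p j] by (auto simp: in_keys_iff split: if_splits)
  qed
  moreover have "f * g = f' * g + Poly_Mapping.single p (Poly_Mapping.lookup f p) * g' +
      Poly_Mapping.single (p + q) (Poly_Mapping.lookup f p * Poly_Mapping.lookup g q)"
    by (simp add: f'_def g'_def mult_single[symmetric] algebra_simps)
  ultimately show ?thesis
    by (simp add: lookup_add in_keys_iff)
qed

lemma laurent_unit_monomial:
  fixes u v :: "'a::idom laurent"
  assumes "u * v = 1"
  shows "\<exists>m a. a \<noteq> 0 \<and> u = Poly_Mapping.single m a"
proof -
  let ?K = "Poly_Mapping.keys u" and ?L = "Poly_Mapping.keys v"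
  have "u \<noteq> 0" "v \<noteq> 0" using assms by auto
  then have ne: "?K \<noteq> {}" "?L \<noteq> {}" by auto
  have one: "p + q = 0" if "p \<in> ?K" "q \<in> ?L"
    and "\<And>i j. i \<in> ?K \<Longrightarrow> j \<in> ?L \<Longrightarrow> i + j = p + q \<Longrightarrow> i = p \<and> j = q" for p q
  proof -
    have "Poly_Mapping.lookup (u * v) (p + q) = Poly_Mapping.lookup u p * Poly_Mapping.lookup v q"
      by (rule lookup_mult_unique) (rule that(3))
    then have "Poly_Mapping.lookup (u * v) (p + q) \<noteq> 0"
      using that(1,2) by (simp add: in_keys_iff)
    then show ?thesis using assms by (auto simp: lookup_one when_def split: if_splits)
  qed
  \<comment> \<open>The extremal exponents have unique sums, and over a domain their coefficients do
    not cancel. As the product is 1, both sums are 0, so the spread of the exponents of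
    \<open>u\<close> is minus that of \<open>v\<close>; neither being negative, \<open>u\<close> has
    a single term.\<close>
  have "Max ?K + Max ?L = 0"
  proof (rule one)
    fix i j assume *: "i \<in> ?K" "j \<in> ?L" "i + j = Max ?K + Max ?L"
    have "i \<le> Max ?K" "j \<le> Max ?L" using * by auto
    then show "i = Max ?K \<and> j = Max ?L" using * by linarith
  qed (use ne in auto)
  moreover have "Min ?K + Min ?L = 0"
  proof (rule one)
    fix i j assume *: "i \<in> ?K" "j \<in> ?L" "i + j = Min ?K + Min ?L"
    have "Min ?K \<le> i" "Min ?L \<le> j" using * by auto
    then show "i = Min ?K \<and> j = Min ?L" using * by linarith
  qed (use ne in auto)
  moreover have "Min ?L \<le> Max ?L" using ne by (intro Min_le Max_in) auto
  ultimately have "Max ?K \<le> Min ?K" by linarith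
  moreover have "Min ?K \<le> i" "i \<le> Max ?K" if "i \<in> ?K" for i
    using that by simp_all
  ultimately have "i = Max ?K" if "i \<in> ?K" for i
    using that by (meson order.antisym order.trans)
  then have "Poly_Mapping.single (Max ?K) (Poly_Mapping.lookup u (Max ?K)) = u"
    by (intro poly_mapping_eqI) (auto simp: lookup_single when_def in_keys_iff)
  moreover have "Poly_Mapping.lookup u (Max ?K) \<noteq> 0"
    using Max_in[of ?K] ne by (simp add: in_keys_iff)
  ultimately show ?thesis by metis
qed

text \<open>This set is closed under products and inverses and contains 1, which makes \<doteq> an
  equivalence compatible with multiplication and inversion.\<close>

definition monomial_factors :: "'a::idom laurent fract set" where
  "monomial_factors = {to_fract (Poly_Mapping.single m a) / to_fract (Poly_Mapping.single 0 b) | m a b. a \<noteq> 0 \<and> b \<noteq> 0}"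

lemma eq_up_to_monomial_iff: "x \<doteq> y \<longleftrightarrow> (\<exists>c\<in>monomial_factors. x = c * y)"
  unfolding eq_up_to_monomial_def monomial_factors_def by blast

lemma single_eq_0_iff: "Poly_Mapping.single k a = 0 \<longleftrightarrow> a = 0"
  by (metis lookup_single_eq lookup_zero single_zero)

lemma one_in_monomial_factors: "1 \<in> monomial_factors"
  unfolding monomial_factors_def
  by (rule CollectI, rule exI[of _ 0], rule exI[of _ 1], rule exI[of _ 1]) simp

lemma monomial_factors_mult:
  assumes "c \<in> monomial_factors" "d \<in> monomial_factors"
  shows "c * d \<in> monomial_factors"
proof -
  obtain m a b m' a' b' where "a \<noteq> 0" "b \<noteq> 0" "a' \<noteq> 0" "b' \<noteq> 0"
    "c = to_fract (Poly_Mapping.single m a) / to_fract (Poly_Mapping.single 0 b)"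
    "d = to_fract (Poly_Mapping.single m' a') / to_fract (Poly_Mapping.single 0 b')"
    using assms unfolding monomial_factors_def by blast
  then show ?thesis
    unfolding monomial_factors_def
    by (intro CollectI exI[of _ "m + m'"] exI[of _ "a * a'"] exI[of _ "b * b'"])
       (simp flip: to_fract_mult mult_single add: mult_single[of 0 _ 0, simplified, symmetric])
qed

lemma monomial_factors_inverse:
  assumes "c \<in> monomial_factors"
  shows "inverse c \<in> monomial_factors"
proof -
  obtain m a b where *: "a \<noteq> 0" "b \<noteq> 0"
    "c = to_fract (Poly_Mapping.single m a) / to_fract (Poly_Mapping.single 0 b)"
    using assms unfolding monomial_factors_def by blast
  \<comment> \<open>Denominators must be constants, so the power of t is moved from the denominator
    of the inverse to its numerator.\<close>
  have "Poly_Mapping.single m a * Poly_Mapping.single (- m) b = Poly_Mapping.single 0 a * Poly_Mapping.single 0 b"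
    by (simp add: mult_single)
  then have "to_fract (Poly_Mapping.single m a) * to_fract (Poly_Mapping.single (- m) b) =
      to_fract (Poly_Mapping.single 0 a) * to_fract (Poly_Mapping.single 0 b)"
    by (metis to_fract_mult)
  then have "to_fract (Poly_Mapping.single 0 b) / to_fract (Poly_Mapping.single m a) =
      to_fract (Poly_Mapping.single (- m) b) / to_fract (Poly_Mapping.single 0 a)"
    using * by (subst frac_eq_eq) (simp_all add: single_eq_0_iff mult.commute)
  then have "inverse c = to_fract (Poly_Mapping.single (- m) b) / to_fract (Poly_Mapping.single 0 a)"
    using * by simp
  then show ?thesis
    unfolding monomial_factors_def using * by blast
qed

lemma monomial_factors_nonzero: "c \<in> monomial_factors \<Longrightarrow> c \<noteq> 0"
  by (auto simp: monomial_factors_def single_eq_0_iff)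

lemma eq_up_to_monomial_refl: "x \<doteq> x"
  unfolding eq_up_to_monomial_iff using one_in_monomial_factors by force

lemma eq_up_to_monomial_sym:
  assumes "x \<doteq> y"
  shows "y \<doteq> x"
proof -
  obtain c where "c \<in> monomial_factors" "x = c * y"
    using assms unfolding eq_up_to_monomial_iff by blast
  then show ?thesis
    unfolding eq_up_to_monomial_iff
    by (intro bexI[of _ "inverse c"] monomial_factors_inverse) (auto dest: monomial_factors_nonzero)
qed

lemma eq_up_to_monomial_trans:
  assumes "x \<doteq> y" "y \<doteq> z"
  shows "x \<doteq> z"
  using assms monomial_factors_mult unfolding eq_up_to_monomial_iff by (metis mult.assoc)

lemma eq_up_to_monomial_mult:
  assumes "x \<doteq> y" "x' \<doteq> y'"
  shows "x * x' \<doteq> y * y'"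
proof -
  obtain c d where "c \<in> monomial_factors" "x = c * y" "d \<in> monomial_factors" "x' = d * y'"
    using assms unfolding eq_up_to_monomial_iff by blast
  then show ?thesis
    unfolding eq_up_to_monomial_iff by (intro bexI[of _ "c * d"] monomial_factors_mult) auto
qed

text \<open>This covers x = 0 as well, since then both inverses are 0; vanishing orders thus need no
  separate treatment.\<close>

lemma eq_up_to_monomial_inverse:
  assumes "x \<doteq> y"
  shows "inverse x \<doteq> inverse y"
proof -
  obtain c where "c \<in> monomial_factors" "x = c * y"
    using assms unfolding eq_up_to_monomial_iff by blast
  then show ?thesis
    unfolding eq_up_to_monomial_iff by (intro bexI[of _ "inverse c"] monomial_factors_inverse) auto
qed

lemma eq_up_to_monomial_prod:
  assumes "\<And>i. i \<in> I \<Longrightarrow> f i \<doteq> g i"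
  shows "prod f I \<doteq> prod g I"
  using assms
  by (induction I rule: infinite_finite_induct) (auto intro: eq_up_to_monomial_refl eq_up_to_monomial_mult)

lemma associated_eq_up_to_monomial:
  fixes d d' :: "'a::idom laurent"
  assumes "d dvd d'" "d' dvd d"
  shows "to_fract d \<doteq> to_fract d'"
proof (cases "d' = 0")
  case True
  then show ?thesis using assms eq_up_to_monomial_refl by auto
next
  case False
  obtain u v where u: "d = d' * u" and v: "d' = d * v" using assms by (auto elim!: dvdE)
  then have "d' * (u * v) = d' * 1" by (metis mult.assoc mult.right_neutral)
  then have "u * v = 1" using False by (metis mult_left_cancel)
  then obtain m a where "a \<noteq> 0" "u = Poly_Mapping.single m a"
    using laurent_unit_monomial by blast
  then show ?thesis
    unfolding eq_up_to_monomial_def u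
    by (intro exI[of _ a] exI[of _ 1] exI[of _ m]) (simp add: mult.commute)
qed


section \<open>Twisted homology\<close>

lemma twisted_action_component:
  "vec_nth (twisted_action \<phi> \<rho> g v) i =
     Poly_Mapping.single (\<phi> g) 1 * (\<Sum>j\<in>UNIV. Poly_Mapping.single 0 (vec_nth (vec_nth (\<rho> g) i) j) * vec_nth v j)"
  by (simp add: twisted_action_def vector_scalar_mult_def matrix_vector_mult_def map_matrix_def)

lemma additive_twisted_action: "Modules.additive (twisted_action \<phi> \<rho> g)"
  by (simp add: Modules.additive_def Finite_Cartesian_Product.vec_eq_iff twisted_action_component distrib_left sum.distrib)

lemma twisted_action_scale: "twisted_action \<phi> \<rho> g (a *s v) = a *s twisted_action \<phi> \<rho> g v"
  by (simp add: Finite_Cartesian_Product.vec_eq_iff twisted_action_component vector_scalar_mult_def sum_distrib_left mult_ac)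

lemma sum_single:
  fixes f :: "'j \<Rightarrow> 'a::ab_group_add"
  shows "(\<Sum>j\<in>J. Poly_Mapping.single k (f j)) = Poly_Mapping.single k (sum f J)"
  by (rule Modules.additive.sum[OF additive_single, symmetric])

lemma twisted_action_mult:
  fixes v :: "'a::comm_ring_1 laurent ^ 'k::finite"
  assumes "\<phi> (g \<otimes>\<^bsub>G\<^esub> h) = \<phi> g + \<phi> h" "\<rho> (g \<otimes>\<^bsub>G\<^esub> h) = \<rho> g ** \<rho> h"
  shows "twisted_action \<phi> \<rho> (g \<otimes>\<^bsub>G\<^esub> h) v = twisted_action \<phi> \<rho> g (twisted_action \<phi> \<rho> h v)"
proof -
  have "(map_matrix (Poly_Mapping.single 0) (\<rho> g ** \<rho> h) :: 'a laurent ^ 'k ^ 'k) =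
      map_matrix (Poly_Mapping.single 0) (\<rho> g) ** map_matrix (Poly_Mapping.single 0) (\<rho> h)"
    by (simp add: Finite_Cartesian_Product.vec_eq_iff map_matrix_def matrix_matrix_mult_def mult_single sum_single)
  moreover have "M *v (c *s w) = c *s (M *v w)" for M :: "'a laurent ^ 'k ^ 'k" and c w
    by (simp add: Finite_Cartesian_Product.vec_eq_iff matrix_vector_mult_def vector_scalar_mult_def sum_distrib_left mult_ac)
  moreover have "(Poly_Mapping.single (\<phi> g + \<phi> h) 1 :: 'a laurent) = Poly_Mapping.single (\<phi> g) 1 * Poly_Mapping.single (\<phi> h) 1"
    by (simp add: mult_single)
  ultimately show ?thesis
    by (simp add: twisted_action_def assms matrix_vector_mul_assoc vector_smult_assoc)
qed

section \<open>Grading of the Laurent module by powers of t\<close>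

definition homogeneous_part :: "int \<Rightarrow> 'a::comm_ring_1 laurent \<Rightarrow> 'a laurent" where
  "homogeneous_part q p = Poly_Mapping.single q (Poly_Mapping.lookup p q)"

lemma additive_homogeneous_part: "Modules.additive (homogeneous_part q)"
  by (simp add: Modules.additive_def homogeneous_part_def lookup_add single_add)

lemma homogeneous_part_mult:
  "homogeneous_part (q + k) (Poly_Mapping.single k a * p) = Poly_Mapping.single k a * homogeneous_part q p"
proof (rule additive_eqI[where S = "\<lambda>p. homogeneous_part (q + k) (Poly_Mapping.single k a * p)"
      and T = "\<lambda>p. Poly_Mapping.single k a * homogeneous_part q p"])
  fix b
  show "homogeneous_part (q + k) (Poly_Mapping.single k a * Poly_Mapping.single b (Poly_Mapping.lookup p b)) =
      Poly_Mapping.single k a * homogeneous_part q (Poly_Mapping.single b (Poly_Mapping.lookup p b))"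
    by (auto simp: homogeneous_part_def mult_single lookup_single when_def add.commute)
qed (simp_all add: Modules.additive_def distrib_left Modules.additive.add[OF additive_homogeneous_part])

definition homogeneous_part_vec :: "int \<Rightarrow> 'a::comm_ring_1 laurent ^ 'k \<Rightarrow> 'a laurent ^ 'k" where
  "homogeneous_part_vec q v = (\<chi> i. homogeneous_part q (vec_nth v i))"

lemma additive_homogeneous_part_vec: "Modules.additive (homogeneous_part_vec q)"
  by (simp add: Modules.additive_def Finite_Cartesian_Product.vec_eq_iff homogeneous_part_vec_def Modules.additive.add[OF additive_homogeneous_part])

lemma finite_homogeneous_part_vec:
  fixes v :: "'a::comm_ring_1 laurent ^ 'k::finite"
  shows "finite {q. homogeneous_part_vec q v \<noteq> 0}"
proof (rule finite_subset)
  show "{q. homogeneous_part_vec q v \<noteq> 0} \<subseteq> (\<Union>i. Poly_Mapping.keys (vec_nth v i))"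
    by (auto simp: homogeneous_part_vec_def homogeneous_part_def Finite_Cartesian_Product.vec_eq_iff in_keys_iff) (metis single_zero)
qed simp

lemma sum_homogeneous_part_vec:
  fixes v :: "'a::comm_ring_1 laurent ^ 'k::finite"
  shows "(\<Sum>q | homogeneous_part_vec q v \<noteq> 0. homogeneous_part_vec q v) = v"
proof -
  have "vec_nth (\<Sum>q | homogeneous_part_vec q v \<noteq> 0. homogeneous_part_vec q v) i = vec_nth v i" for i
  proof -
    have "(\<Sum>q | homogeneous_part_vec q v \<noteq> 0. homogeneous_part q (vec_nth v i)) =
        (\<Sum>q\<in>Poly_Mapping.keys (vec_nth v i). homogeneous_part q (vec_nth v i))"
    proof (rule sum.mono_neutral_right[OF finite_homogeneous_part_vec])
      show "Poly_Mapping.keys (vec_nth v i) \<subseteq> {q. homogeneous_part_vec q v \<noteq> 0}"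
        by (auto simp: homogeneous_part_vec_def homogeneous_part_def Finite_Cartesian_Product.vec_eq_iff in_keys_iff single_eq_0_iff)
    qed (auto simp: homogeneous_part_def in_keys_iff)
    then show ?thesis
      by (simp add: homogeneous_part_vec_def) (simp add: homogeneous_part_def sum_single_lookup)
  qed
  then show ?thesis by (simp add: Finite_Cartesian_Product.vec_eq_iff)
qed

lemma homogeneous_part_vec_idem:
  "homogeneous_part_vec p (homogeneous_part_vec q v) = (if p = q then homogeneous_part_vec q v else 0)"
  by (auto simp: homogeneous_part_vec_def homogeneous_part_def Finite_Cartesian_Product.vec_eq_iff lookup_single)

text \<open>The entries of \<rho> g are constants and preserve degrees; the factor t^{\<phi> g}
  shifts them.\<close>

lemma homogeneous_part_vec_twisted_action:
  "homogeneous_part_vec (q + \<phi> g) (twisted_action \<phi> \<rho> g v) = twisted_action \<phi> \<rho> g (homogeneous_part_vec q v)"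
  by (simp add: Finite_Cartesian_Product.vec_eq_iff homogeneous_part_vec_def twisted_action_component homogeneous_part_mult
      homogeneous_part_mult[of _ 0, simplified]
      Modules.additive.sum[OF additive_homogeneous_part])

context bar_complex
begin

lemma additive_map:
  assumes "Modules.additive (f :: 'm \<Rightarrow> 'm)"
  shows "Modules.additive (Poly_Mapping.map f :: ('b \<Rightarrow>\<^sub>0 'm) \<Rightarrow> _)"
proof
  fix c d :: "'b \<Rightarrow>\<^sub>0 'm"
  show "Poly_Mapping.map f (c + d) = Poly_Mapping.map f c + Poly_Mapping.map f d"
    by (rule poly_mapping_eqI)
       (auto simp: map.rep_eq lookup_add when_def Modules.additive.add[OF assms] Modules.additive.zero[OF assms]
         simp flip: Modules.additive.add[OF assms])
qed

lemma bar_boundary_map: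
  assumes f: "Modules.additive f" and comm: "\<And>g m. act g (f m) = f (act g m)"
  shows "bar_boundary G act (Poly_Mapping.map f c) = Poly_Mapping.map f (bar_boundary G act c)"
proof (rule additive_eqI[where S = "\<lambda>c. bar_boundary G act (Poly_Mapping.map f c)"
      and T = "\<lambda>c. Poly_Mapping.map f (bar_boundary G act c)"])
  fix gs
  have face: "bar_face G act i gs (f m) = Poly_Mapping.map f (bar_face G act i gs m)" for i m
    using Modules.additive.zero[OF f] by (simp add: bar_face_def comm)
  show "bar_boundary G act (Poly_Mapping.map f (Poly_Mapping.single gs (Poly_Mapping.lookup c gs))) =
      Poly_Mapping.map f (bar_boundary G act (Poly_Mapping.single gs (Poly_Mapping.lookup c gs)))"
    using Modules.additive.zero[OF f]
    by (simp add: Modules.additive.zero[OF additive_map[OF f]] bar_boundary_eq first_face_def upper_boundary_single face if_distrib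
        Modules.additive.add[OF additive_map[OF f]] Modules.additive.sum[OF additive_map[OF f]]
        Modules.additive.minus[OF additive_map[OF f]] cong: if_cong)
qed (auto intro!: additive_map f additive_bar_boundary additive_compose[where S = "bar_boundary G act"]
      additive_compose[where S = "Poly_Mapping.map f"])

text \<open>Each coset of a cycle is the set of boundaries itself, so the quotient record has one
  element. As it is a bare record, closure of the boundaries under sums and scalars is checked to
  obtain the operations on that element.\<close>

lemma is_order_of_acyclic_homology:
  fixes sm :: "'l::comm_ring_1 \<Rightarrow> 'm \<Rightarrow> 'm"
  assumes sub: "bar_cycles G act n \<subseteq> bar_boundaries G act n"
    and sm: "\<And>a. Modules.additive (sm a)" "\<And>a g m. act g (sm a m) = sm a (act g m)"
  shows "is_order_of_module (group_homology G sm act n) 1"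
proof -
  let ?Z = "bar_cycles G act n" and ?B = "bar_boundaries G act n"
  have add: "x + y \<in> ?B" if "x \<in> ?B" "y \<in> ?B" for x y
    using that by (auto simp: bar_boundaries_def Modules.additive.add[OF additive_bar_boundary, symmetric]
        intro!: imageI add_in_bar_chains)
  have minus: "- x \<in> ?B" if "x \<in> ?B" for x
    using that by (auto simp: bar_boundaries_def Modules.additive.minus[OF additive_bar_boundary, symmetric]
        intro!: imageI uminus_in_bar_chains)
  have zero: "0 \<in> ?B"
    unfolding bar_boundaries_def
    by (rule image_eqI[OF _ zero_in_bar_chains]) (simp add: Modules.additive.zero[OF additive_bar_boundary])
  have scale: "Poly_Mapping.map (sm a) x \<in> ?B" if x: "x \<in> ?B" for a x
  proof -
    obtain c where c: "c \<in> bar_chains G (Suc n)" "x = bar_boundary G act c"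
      using x unfolding bar_boundaries_def by blast
    have "Poly_Mapping.map (sm a) c \<in> bar_chains G (Suc n)"
      using c(1) by (auto simp: bar_chains_def in_keys_iff map.rep_eq when_def split: if_splits)
    then show ?thesis
      unfolding bar_boundaries_def c(2) bar_boundary_map[OF sm, symmetric] by (rule imageI)
  qed
  have coset: "(+) z ` ?B = ?B" if "z \<in> ?B" for z
  proof
    show "(+) z ` ?B \<subseteq> ?B" using that add by auto
    show "?B \<subseteq> (+) z ` ?B"
      using add[OF minus[OF that]] by (auto intro!: image_eqI[of _ _ "- z + _"])
  qed
  have "0 \<in> ?Z"
    by (simp add: bar_cycles_def zero_in_bar_chains Modules.additive.zero[OF additive_bar_boundary])
  then have carrier: "(\<lambda>z. (+) z ` ?B) ` ?Z = {?B}"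
  proof -
    have "(\<lambda>z. (+) z ` ?B) ` ?Z = (\<lambda>z. ?B) ` ?Z"
      using sub by (intro image_cong refl coset) blast
    then show ?thesis using \<open>0 \<in> ?Z\<close> by (simp add: image_constant)
  qed
  have sum: "{x + y | x y. x \<in> ?B \<and> y \<in> ?B} = ?B"
    using add zero by (auto intro: exI[of _ 0])
  have smult: "{Poly_Mapping.map (sm a) x + b | x b. x \<in> ?B \<and> b \<in> ?B} = ?B" for a
  proof
    show "{Poly_Mapping.map (sm a) x + b | x b. x \<in> ?B \<and> b \<in> ?B} \<subseteq> ?B" using add scale by auto
    show "?B \<subseteq> {Poly_Mapping.map (sm a) x + b | x b. x \<in> ?B \<and> b \<in> ?B}"
    proof
      fix b assume "b \<in> ?B"
      moreover have "b = Poly_Mapping.map (sm a) 0 + b"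
        by (simp add: Modules.additive.zero[OF additive_map[OF sm(1)]])
      ultimately show "b \<in> {Poly_Mapping.map (sm a) x + b | x b. x \<in> ?B \<and> b \<in> ?B}"
        using zero by blast
    qed
  qed
  show ?thesis
    by (rule is_order_of_zero_module)
       (simp_all add: group_homology_def quotient_module_def carrier sum smult)
qed

end

text \<open>The letters of prescribed degree are powers of the stable letter, and the free basis
  sits in the kernel as pairs with second entry 0.\<close>

lemma graded_bar_complex_free_by_cyclic:
  fixes \<rho> :: "'f \<times> int \<Rightarrow> 'a::comm_ring_1 ^ 'k::finite ^ 'k"
  assumes "group F" "finite X" "free_basis F X" and \<alpha>: "\<alpha> \<in> hom integer_group (AutoGroup F)"
    and \<rho>: "\<rho> \<in> hom (free_by_cyclic F \<alpha>) GL"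
  shows "graded_bar_complex (free_by_cyclic F \<alpha>) (twisted_action induced_character \<rho>) induced_character
    homogeneous_part_vec (\<lambda>q. (\<one>\<^bsub>F\<^esub>, - q)) ((\<lambda>x. (x, 0)) ` X)"
proof -
  interpret F: free_group F X
    using assms by (simp add: free_group_def free_group_axioms_def)
  let ?G = "free_by_cyclic F \<alpha>"
  interpret G: group ?G
    using group_semidirect_product[OF assms(1) group_integer_group \<alpha>] .
  have carrier: "carrier ?G = carrier F \<times> UNIV"
    by (simp add: semidirect_product_def)
  have mult: "(x, a) \<otimes>\<^bsub>?G\<^esub> (y, b) = (x \<otimes>\<^bsub>F\<^esub> \<alpha> a y, a + b)" for x y a b
    by (simp add: semidirect_product_def)
  have one: "\<one>\<^bsub>?G\<^esub> = (\<one>\<^bsub>F\<^esub>, 0)"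
    by (simp add: semidirect_product_def)
  have \<alpha>0: "\<alpha> 0 x = x" if "x \<in> carrier F" for x
    using hom_one[OF \<alpha> group_integer_group F.AutoGroup] that
    by (simp add: AutoGroup_def BijGroup_def)
  have inv: "inv\<^bsub>?G\<^esub> (x, 0) = (inv\<^bsub>F\<^esub> x, 0)" if "x \<in> carrier F" for x
    using that by (intro G.inv_equality) (simp_all add: mult one carrier \<alpha>0)
  have X: "X \<subseteq> carrier F" by (rule F.basis_carrier)
  interpret \<iota>: group_hom F ?G "\<lambda>x. (x, 0)"
    by unfold_locales (auto simp: hom_def carrier mult \<alpha>0)
  have degree: "induced_character (g \<otimes>\<^bsub>?G\<^esub> h) = induced_character g + induced_character h" for g h
    by (cases g; cases h) (simp add: induced_character_def mult)
  show ?thesis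
  proof (unfold_locales)
    fix g h and m :: "'a laurent ^ 'k"
    assume "g \<in> carrier ?G" "h \<in> carrier ?G"
    then have "\<rho> (g \<otimes>\<^bsub>?G\<^esub> h) = \<rho> g ** \<rho> h"
      using hom_mult[OF \<rho>] by (simp add: GL_def)
    then show "twisted_action induced_character \<rho> (g \<otimes>\<^bsub>?G\<^esub> h) m =
        twisted_action induced_character \<rho> g (twisted_action induced_character \<rho> h m)"
      by (rule twisted_action_mult[where \<phi> = induced_character and G = ?G and g = g and h = h, OF degree])
  next
    fix g assume "g \<in> carrier ?G" "induced_character g = 0"
    then obtain x where "g = (x, 0)" "x \<in> carrier F"
      by (auto simp: carrier induced_character_def)
    then show "g \<in> generate ?G ((\<lambda>x. (x, 0)) ` X)"
      using \<iota>.generate_img[OF X] assms(3) by (simp add: free_basis_def)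
  next
    fix d :: "'f \<times> int \<Rightarrow> 'f \<times> int \<Rightarrow> 'a laurent ^ 'k" and x' v' :: "'f \<times> int"
    assume fin: "\<And>x. x \<in> (\<lambda>x. (x, 0)) ` X \<Longrightarrow> finite {v. d x v \<noteq> 0}"
      and eq: "\<And>v. v \<in> carrier ?G \<Longrightarrow>
        (\<Sum>x\<in>(\<lambda>x. (x, 0)) ` X. d x (inv\<^bsub>?G\<^esub> x \<otimes>\<^bsub>?G\<^esub> v) - d x v) = 0"
      and "x' \<in> (\<lambda>x. (x, 0)) ` X" "v' \<in> carrier ?G"
    then obtain x v k where x: "x' = (x, 0)" "x \<in> X" and v: "v' = (v, k)" "v \<in> carrier F"
      by (auto simp: carrier)
    \<comment> \<open>Left multiplication by the kernel preserves the second entry \<open>k\<close>,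
      so G splits into copies of F and the relation is restricted to one of them. On it
      \<open>\<alpha> 0\<close> is the identity, and the relation becomes one in F.\<close>
    define d' where "d' y u = d (y, 0) (u, k)" for y u
    have "finite {u. d' y u \<noteq> 0}" if "y \<in> X" for y
    proof -
      have "finite ((\<lambda>u. (u, k)) -` {v. d (y, 0) v \<noteq> 0})"
        by (intro finite_vimageI fin imageI that) (simp add: inj_on_def)
      moreover have "(\<lambda>u. (u, k)) -` {v. d (y, 0) v \<noteq> 0} = {u. d' y u \<noteq> 0}"
        unfolding d'_def by (rule vimage_Collect_eq)
      ultimately show ?thesis by (simp only:)
    qed
    moreover have "(\<Sum>y\<in>X. d' y (inv\<^bsub>F\<^esub> y \<otimes>\<^bsub>F\<^esub> u) - d' y u) = 0" if u: "u \<in> carrier F" for u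
    proof -
      have "(\<Sum>y\<in>X. d' y (inv\<^bsub>F\<^esub> y \<otimes>\<^bsub>F\<^esub> u) - d' y u) =
          (\<Sum>y\<in>X. d (y, 0) (inv\<^bsub>?G\<^esub> (y, 0) \<otimes>\<^bsub>?G\<^esub> (u, k)) - d (y, 0) (u, k))"
      proof (rule sum.cong)
        fix y assume "y \<in> X"
        then have "y \<in> carrier F" using X by blast
        then have "inv\<^bsub>?G\<^esub> (y, 0) \<otimes>\<^bsub>?G\<^esub> (u, k) = (inv\<^bsub>F\<^esub> y \<otimes>\<^bsub>F\<^esub> u, k)"
          using u by (simp only: inv mult \<alpha>0 add_0)
        then show "d' y (inv\<^bsub>F\<^esub> y \<otimes>\<^bsub>F\<^esub> u) - d' y u =
            d (y, 0) (inv\<^bsub>?G\<^esub> (y, 0) \<otimes>\<^bsub>?G\<^esub> (u, k)) - d (y, 0) (u, k)"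
          by (simp add: d'_def)
      qed simp
      also have "\<dots> = (\<Sum>x\<in>(\<lambda>x. (x, 0)) ` X. d x (inv\<^bsub>?G\<^esub> x \<otimes>\<^bsub>?G\<^esub> (u, k)) - d x (u, k))"
        by (subst sum.reindex) (simp_all add: inj_on_def)
      also have "\<dots> = 0"
        by (rule eq) (simp add: carrier u)
      finally show ?thesis .
    qed
    ultimately have "d' x v = 0"
      using assms(2) x(2) v(2) by (intro F.basis_independent[of d' x v])
    then show "d x' v' = 0" by (simp add: x v d'_def)
  qed (use X assms(2) in \<open>auto simp: degree carrier mult finite_homogeneous_part_vec sum_homogeneous_part_vec
      homogeneous_part_vec_idem homogeneous_part_vec_twisted_action induced_character_def
      Modules.additive.add[OF additive_twisted_action] Modules.additive.add[OF additive_homogeneous_part_vec]\<close>)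
qed

lemma is_twisted_alexander_polynomial_high_degree:
  fixes \<rho> :: "'f \<times> int \<Rightarrow> 'a::comm_ring_1 ^ 'k::finite ^ 'k"
  assumes "free_group_of_rank F n" "\<alpha> \<in> hom integer_group (AutoGroup F)"
    "\<rho> \<in> hom (free_by_cyclic F \<alpha>) GL" "2 \<le> i"
  shows "is_twisted_alexander_polynomial (free_by_cyclic F \<alpha>) induced_character \<rho> i 1"
proof -
  obtain X where X: "group F" "finite X" "free_basis F X"
    using assms(1) by (auto simp: free_group_of_rank_def)
  interpret graded_bar_complex "free_by_cyclic F \<alpha>" "twisted_action induced_character \<rho>" induced_character
    homogeneous_part_vec "\<lambda>q. (\<one>\<^bsub>F\<^esub>, - q)" "(\<lambda>x. (x, 0)) ` X"
    using X assms(2,3) by (rule graded_bar_complex_free_by_cyclic)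
  show ?thesis
    unfolding is_twisted_alexander_polynomial_def twisted_homology_def
    by (rule is_order_of_acyclic_homology[OF bar_cycles_subset_bar_boundaries[OF \<open>2 \<le> i\<close>]])
       (auto simp: Modules.additive_def Finite_Cartesian_Product.vec_eq_iff twisted_action_scale distrib_left)
qed

theorem proposition3p10:
  fixes F :: "'f monoid" and n :: nat and \<alpha> :: "int \<Rightarrow> 'f \<Rightarrow> 'f"
    and G :: "('f \<times> int) monoid" and \<phi> :: "'f \<times> int \<Rightarrow> int"
    and \<rho> :: "'f \<times> int \<Rightarrow> 'a::{factorial_semiring, idom} ^ 'k::finite ^ 'k"
    and \<Delta>\<^sub>0 \<Delta>\<^sub>1 :: "'a laurent" and \<tau> :: "'a laurent fract"
  assumes "free_group_of_rank F n" and "n \<ge> 1"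
    and "\<alpha> \<in> hom integer_group (AutoGroup F)"
    and "G = free_by_cyclic F \<alpha>" and "\<phi> = induced_character"
    and "\<rho> \<in> hom G GL"
    and "is_twisted_alexander_polynomial G \<phi> \<rho> 0 \<Delta>\<^sub>0"
    and "is_twisted_alexander_polynomial G \<phi> \<rho> 1 \<Delta>\<^sub>1"
  shows "is_twisted_reidemeister_torsion G \<phi> \<rho> \<tau> \<longleftrightarrow> \<tau> \<doteq> to_fract \<Delta>\<^sub>1 / to_fract \<Delta>\<^sub>0"
proof -
  \<comment> \<open>A reference family of representatives. Every other family is compared with it,
    and it is the witness for the existence of a torsion in the converse direction.\<close>
  define D where "D i = (if i = 0 then \<Delta>\<^sub>0 else if i = 1 then \<Delta>\<^sub>1 else 1)" for i :: nat
  have D: "is_twisted_alexander_polynomial G \<phi> \<rho> i (D i)" for i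
    using is_twisted_alexander_polynomial_high_degree[OF assms(1,3), of \<rho> i] assms by (auto simp: D_def)
  define e :: "nat \<Rightarrow> int" where "e i = (- 1) ^ (i + 1)" for i
  have e: "e i = 1 \<or> e i = - 1" for i
    by (cases "even i") (auto simp: e_def)
  have factor: "to_fract (\<Delta> i) powi e i \<doteq> to_fract (D i) powi e i"
    if "is_twisted_alexander_polynomial G \<phi> \<rho> i (\<Delta> i)" for \<Delta> :: "nat \<Rightarrow> 'a laurent" and i
  proof -
    have "to_fract (\<Delta> i) \<doteq> to_fract (D i)"
      using that D[of i] unfolding is_twisted_alexander_polynomial_def
      by (intro associated_eq_up_to_monomial is_order_of_module_dvd)
    then show ?thesis
      using e[of i] by (auto simp: power_int_minus eq_up_to_monomial_inverse)
  qed
  have prod_D: "(\<Prod>i\<in>I. to_fract (D i) powi e i) = to_fract \<Delta>\<^sub>1 / to_fract \<Delta>\<^sub>0"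
    if "finite I" "{0, 1} \<subseteq> I" for I
  proof -
    have "(\<Prod>i\<in>I. to_fract (D i) powi e i) = (\<Prod>i\<in>{0, 1}. to_fract (D i) powi e i)"
      using that by (intro prod.mono_neutral_right) (auto simp: D_def)
    also have "\<dots> = to_fract \<Delta>\<^sub>1 / to_fract \<Delta>\<^sub>0"
      by (simp add: D_def e_def power_int_minus divide_inverse mult.commute)
    finally show ?thesis .
  qed
  have torsion: "(\<Prod>i | \<Delta> i \<noteq> 1. to_fract (\<Delta> i) powi e i) \<doteq> to_fract \<Delta>\<^sub>1 / to_fract \<Delta>\<^sub>0"
    if "\<And>i. is_twisted_alexander_polynomial G \<phi> \<rho> i (\<Delta> i)" "finite {i. \<Delta> i \<noteq> 1}" for \<Delta> :: "nat \<Rightarrow> 'a laurent"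
  proof -
    \<comment> \<open>The degrees where another family differs from 1 need not be 0 and 1. Over this
      common index set the additional factors of that family are 1, and those of \<open>D\<close>
      are 1 from degree two on.\<close>
    let ?I = "{0, 1} \<union> {i. \<Delta> i \<noteq> 1}"
    have "(\<Prod>i | \<Delta> i \<noteq> 1. to_fract (\<Delta> i) powi e i) = (\<Prod>i\<in>?I. to_fract (\<Delta> i) powi e i)"
      using that(2) by (intro prod.mono_neutral_left) auto
    also have "\<dots> \<doteq> (\<Prod>i\<in>?I. to_fract (D i) powi e i)"
      by (intro eq_up_to_monomial_prod factor that(1))
    also have "(\<Prod>i\<in>?I. to_fract (D i) powi e i) = to_fract \<Delta>\<^sub>1 / to_fract \<Delta>\<^sub>0"
      using that(2) by (intro prod_D) auto
    finally show ?thesis .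
  qed
  show ?thesis
  proof
    assume "is_twisted_reidemeister_torsion G \<phi> \<rho> \<tau>"
    then obtain \<Delta> where "\<And>i. is_twisted_alexander_polynomial G \<phi> \<rho> i (\<Delta> i)" "finite {i. \<Delta> i \<noteq> 1}"
      "\<tau> \<doteq> (\<Prod>i | \<Delta> i \<noteq> 1. to_fract (\<Delta> i) powi e i)"
      unfolding is_twisted_reidemeister_torsion_def e_def by blast
    then show "\<tau> \<doteq> to_fract \<Delta>\<^sub>1 / to_fract \<Delta>\<^sub>0"
      using torsion eq_up_to_monomial_trans by blast
  next
    assume "\<tau> \<doteq> to_fract \<Delta>\<^sub>1 / to_fract \<Delta>\<^sub>0"
    moreover have fin: "finite {i. D i \<noteq> 1}"
      by (rule finite_subset[of _ "{0, 1}"]) (auto simp: D_def)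
    ultimately have "\<tau> \<doteq> (\<Prod>i | D i \<noteq> 1. to_fract (D i) powi e i)"
      using torsion[OF D fin] eq_up_to_monomial_sym eq_up_to_monomial_trans by blast
    then show "is_twisted_reidemeister_torsion G \<phi> \<rho> \<tau>"
      unfolding is_twisted_reidemeister_torsion_def e_def using D fin by blast
  qed
qed

end
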